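(* Let $m^{(i)},m^{(j)}>0$ be two particle masses, let $\mathcal T>0$, and set $\zeta^{(i)}=\mathcal T/m^{(i)}$, $\zeta^{(j)}=\mathcal T/m^{(j)}$ and $r=m^{(j)}/m^{(i)}=\zeta^{(i)}/\zeta^{(j)}$. For multi-indices $\alpha,\lambda,\kappa\in\mathbb N^3$ define $$A^{(ij)}_{\alpha,\lambda\kappa}=\frac{1}{\alpha!}\int_{\mathbb R^3}\int_{\mathbb R^3}\int_{S^2}B_{ij}(|\mathbf v-\mathbf v_*|,\varsigma)\Big[\mathcal H^{(i)}_{\lambda}(\mathbf v')\mathcal H^{(j)}_{\kappa}(\mathbf v'_* )-\mathcal H^{(i)}_{\lambda}(\mathbf v)\mathcal H^{(j)}_{\kappa}(\mathbf v_* )\Big]H^{\mathbf 0,\zeta^{(i)}}_{\alpha}(\mathbf v)\,d\varsigma\,d\mathbf v\,d\mathbf v_*,$$ where $\mathcal H^{(i)}_\lambda(\mathbf v)=H^{\mathbf 0,\zeta^{(i)}}_\lambda(\mathbf v)\mathcal M_{\mathbf 0,\zeta^{(i)}}(\mathbf v)$, $\mathcal H^{(j)}_\kappa(\mathbf v)=H^{\mathbf 0,\zeta^{(j)}}_\kappa(\mathbf v)\mathcal M_{\mathbf 0,\zeta^{(j)}}(\mathbf v)$, and $$\mathbf v'=\frac{m^{(i)}\mathbf v+m^{(j)}\mathbf v_*}{m^{(i)}+m^{(j)}}+\frac{m^{(j)}}{m^{(i)}+m^{(j)}}|\mathbf v-\mathbf v_*|\varsigma,\qquad \mathbf v'_*=\frac{m^{(i)}\mathbf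 v+m^{(j)}\mathbf v_*}{m^{(i)}+m^{(j)}}-\frac{m^{(i)}}{m^{(i)}+m^{(j)}}|\mathbf v-\mathbf v_*|\varsigma.$$ Then, writing $\lambda=(l_1,l_2,l_3)$, $\kappa=(k_1,k_2,k_3)$, $$A^{(ij)}_{\alpha,\lambda\kappa}=\frac{r^{3/2}}{(1+r)^{\frac{|\alpha|+3}{2}}}\sum_{\lambda'\preceq\alpha,\ \lambda'\preceq\kappa+\lambda}\frac{r^{|\mathbf j|/2}}{\mathbf j!}\,c^{l_1k_1}_{l'_1k'_1}(r)\,c^{l_2k_2}_{l'_2k'_2}(r)\,c^{l_3k_3}_{l'_3k'_3}(r)\,\gamma^{\mathbf j}_{\kappa'}(r,\zeta^{(i)}),$$ where the sum is over $\lambda'=(l'_1,l'_2,l'_3)\in\mathbb N^3$, $\kappa'=(k'_1,k'_2,k'_3)=\kappa+\lambda-\lambda'$, $\mathbf j=\alpha-\lambda'$, the coefficients are $$c^{l_dk_d}_{l'_dk'_d}(r)=(1+r)^{-\frac{l'_d+k'_d}{2}}\sum_{s\in\mathbb Z}C_{l_d}^{s}C_{k_d}^{l'_d-s}(-1)^{k_d-l'_d+s}r^{\frac{l_d+l'_d}{2}-s},$$ and for $\overline T>0$, $$\gamma^{\mathbf j}_{\kappa'}(r,\overline T)=\int_{\mathbb R^3}\int_{S^2}\Big[H^{\mathbf 0,\overline T}_{\mathbf j}\Big(\sqrt{\tfrac{r}{1+r}}\,\mathbf g'\Big)-H^{\mathbf 0,\overline T}_{\mathbf j}\Big(\sqrt{\tfrac{r}{1+r}}\,\mathbf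 g\Big)\Big]H^{\mathbf 0,\overline T}_{\kappa'}\Big(\sqrt{\tfrac{r}{1+r}}\,\mathbf g\Big)B_{ij}(|\mathbf g|,\varsigma)\,\mathcal M_{\mathbf 0,\overline T}\Big(\sqrt{\tfrac{r}{1+r}}\,\mathbf g\Big)\,d\varsigma\,d\mathbf g,$$ with $\mathbf g=\mathbf v-\mathbf v_*$ the relative velocity and $\mathbf g'=|\mathbf g|\varsigma$.
   Context: For $\mathbf u\in\mathbb R^3$, $T>0$, the Maxwellian is $\mathcal M_{\mathbf u,T}(\mathbf v)=(2\pi T)^{-3/2}\exp\!\big(-|\mathbf v-\mathbf u|^2/(2T)\big)$. For $\alpha=(\alpha_1,\alpha_2,\alpha_3)\in\mathbb N^3$, $|\alpha|=\alpha_1+\alpha_2+\alpha_3$, $\alpha!=\alpha_1!\alpha_2!\alpha_3!$, and the Hermite polynomial is $H^{\mathbf u,T}_\alpha(\mathbf v)=\frac{(-1)^{|\alpha|}T^{|\alpha|/2}}{\mathcal M_{\mathbf u,T}(\mathbf v)}\frac{\partial^{|\alpha|}}{\partial v_1^{\alpha_1}\partial v_2^{\alpha_2}\partial v_3^{\alpha_3}}\mathcal M_{\mathbf u,T}(\mathbf v)$. For multi-indices, $(i_1,i_2,i_3)\preceq(j_1,j_2,j_3)$ means $i_s\le j_s$ for $s=1,2,3$. $C_n^k$ denotes the binomial coefficient, taken to be $0$ when $k<0$ or $k>n$. The collision kernel $B_{ij}(|\mathbf g|,\varsigma)$, $\mathbf g\in\mathbb R^3$, $\varsigma\in S^2$,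 is a nonnegative function depending only on $|\mathbf g|$ and the deviation angle $\chi=\arccos(\varsigma\cdot\mathbf g/|\mathbf g|)$ (as for the VSS/VHS kernels of the multi-species Boltzmann equation), and the integrals are assumed to converge. *)

theory Defs
  imports "HOL-Analysis.Analysis"
begin

definition maxwellian :: "real^3 \<Rightarrow> real \<Rightarrow> real^3 \<Rightarrow> real" where
  "maxwellian u T v = (2 * pi * T) powr (-3/2) * exp (- ((norm (v - u))\<^sup>2) / (2 * T))"

definition mabs :: "nat^3 \<Rightarrow> nat" where
  "mabs a = a$1 + a$2 + a$3"

definition mfact :: "nat^3 \<Rightarrow> nat" where
  "mfact a = fact (a$1) * fact (a$2) * fact (a$3)"

definition mle :: "nat^3 \<Rightarrow> nat^3 \<Rightarrow> bool" where
  "mle a b \<longleftrightarrow> (\<forall>i. a$i \<le> b$i)"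

definition partial :: "3 \<Rightarrow> (real^3 \<Rightarrow> real) \<Rightarrow> real^3 \<Rightarrow> real" where
  "partial i f x = deriv (\<lambda>t. f (x + t *\<^sub>R axis i 1)) 0"

definition mderiv :: "nat^3 \<Rightarrow> (real^3 \<Rightarrow> real) \<Rightarrow> real^3 \<Rightarrow> real" where
  "mderiv a f = (partial 1 ^^ (a$1)) ((partial 2 ^^ (a$2)) ((partial 3 ^^ (a$3)) f))"

definition hermite :: "real^3 \<Rightarrow> real \<Rightarrow> nat^3 \<Rightarrow> real^3 \<Rightarrow> real" where
  "hermite u T a v = (-1) ^ mabs a * T powr (real (mabs a) / 2) / maxwellian u T v
      * mderiv a (maxwellian u T) v"

text \<open>Integration over S^2 with surface measure d\<sigma> is realised through the
  parametrisation (theta, phi) in [0,pi] x [0,2pi], d\<sigma> = sin theta dtheta dphi.\<close>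
definition sph :: "real \<times> real \<Rightarrow> real^3" where
  "sph p = (\<chi> i. if i = 1 then sin (fst p) * cos (snd p)
                 else if i = 2 then sin (fst p) * sin (snd p)
                 else cos (fst p))"

definition sph_dom :: "(real \<times> real) set" where
  "sph_dom = {0..pi} \<times> {0..2*pi}"

definition collB :: "(real \<Rightarrow> real \<Rightarrow> real) \<Rightarrow> real^3 \<Rightarrow> real^3 \<Rightarrow> real" where
  "collB Bk g \<sigma> = Bk (norm g) (arccos ((\<sigma> \<bullet> g) / norm g))"

definition vpost :: "real \<Rightarrow> real \<Rightarrow> real^3 \<Rightarrow> real^3 \<Rightarrow> real^3 \<Rightarrow> real^3" where
  "vpost mi mj v vs \<sigma> = (1 / (mi + mj)) *\<^sub>R (mi *\<^sub>R v + mj *\<^sub>R vs)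
      + (mj / (mi + mj) * norm (v - vs)) *\<^sub>R \<sigma>"

definition vspost :: "real \<Rightarrow> real \<Rightarrow> real^3 \<Rightarrow> real^3 \<Rightarrow> real^3 \<Rightarrow> real^3" where
  "vspost mi mj v vs \<sigma> = (1 / (mi + mj)) *\<^sub>R (mi *\<^sub>R v + mj *\<^sub>R vs)
      - (mi / (mi + mj) * norm (v - vs)) *\<^sub>R \<sigma>"

definition calH :: "real \<Rightarrow> nat^3 \<Rightarrow> real^3 \<Rightarrow> real" where
  "calH T a v = hermite 0 T a v * maxwellian 0 T v"

definition A_integrand ::
  "real \<Rightarrow> real \<Rightarrow> real \<Rightarrow> (real \<Rightarrow> real \<Rightarrow> real) \<Rightarrow> nat^3 \<Rightarrow> nat^3 \<Rightarrow> nat^3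
    \<Rightarrow> (real^3) \<times> (real^3) \<times> (real \<times> real) \<Rightarrow> real" where
  "A_integrand mi mj T Bk al la ka x =
     (let v = fst x; vs = fst (snd x); p = snd (snd x); \<sigma> = sph p;
          zi = T / mi; zj = T / mj
      in collB Bk (v - vs) \<sigma>
         * (calH zi la (vpost mi mj v vs \<sigma>) * calH zj ka (vspost mi mj v vs \<sigma>)
            - calH zi la v * calH zj ka vs)
         * hermite 0 zi al v * sin (fst p))"

definition A_coef ::
  "real \<Rightarrow> real \<Rightarrow> real \<Rightarrow> (real \<Rightarrow> real \<Rightarrow> real) \<Rightarrow> nat^3 \<Rightarrow> nat^3 \<Rightarrow> nat^3 \<Rightarrow> real" where
  "A_coef mi mj T Bk al la ka =
     1 / real (mfact al) *
     (LINT x : UNIV \<times> UNIV \<times> sph_dom | lborel. A_integrand mi mj T Bk al la ka x)"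

definition gamma_integrand ::
  "(real \<Rightarrow> real \<Rightarrow> real) \<Rightarrow> real \<Rightarrow> real \<Rightarrow> nat^3 \<Rightarrow> nat^3
     \<Rightarrow> (real^3) \<times> (real \<times> real) \<Rightarrow> real" where
  "gamma_integrand Bk r Tb j k x =
     (let g = fst x; p = snd x; \<sigma> = sph p; g' = norm g *\<^sub>R \<sigma>; c = sqrt (r / (1 + r))
      in (hermite 0 Tb j (c *\<^sub>R g') - hermite 0 Tb j (c *\<^sub>R g))
         * hermite 0 Tb k (c *\<^sub>R g) * collB Bk g \<sigma> * maxwellian 0 Tb (c *\<^sub>R g)
         * sin (fst p))"

definition gamma_coef ::
  "(real \<Rightarrow> real \<Rightarrow> real) \<Rightarrow> real \<Rightarrow> real \<Rightarrow> nat^3 \<Rightarrow> nat^3 \<Rightarrow> real" where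
  "gamma_coef Bk r Tb j k =
     (LINT x : UNIV \<times> sph_dom | lborel. gamma_integrand Bk r Tb j k x)"

definition binomZ :: "nat \<Rightarrow> int \<Rightarrow> real" where
  "binomZ n k = (if 0 \<le> k \<and> k \<le> int n then real (n choose nat k) else 0)"

text \<open>c^{l k}_{l' k'}(r); the sum over s in Z reduces to s in [0, l] since C_l^s = 0
  otherwise.\<close>
definition ccoef :: "nat \<Rightarrow> nat \<Rightarrow> nat \<Rightarrow> nat \<Rightarrow> real \<Rightarrow> real" where
  "ccoef l k l' k' r = (1 + r) powr (- (real l' + real k') / 2) *
     (\<Sum>s\<in>{0..int l}. binomZ l s * binomZ k (int l' - s)
        * (-1) powi (int k - int l' + s) * r powr ((real l + real l') / 2 - real_of_int s))"

end

theory Submission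
  imports Defs "HOL-Probability.Probability" "HOL-Computational_Algebra.Polynomial"
begin

text \<open>
  With \<open>v = h + r / (1 + r) g\<close>, \<open>v\<^sub>* = h - 1 / (1 + r) g\<close> (Jacobian 1), the variables
  \<open>\<surd>(1 + r) h\<close> and \<open>\<surd>(r / (1 + r)) g\<close> arise from \<open>v\<close>, \<open>\<surd>r v\<^sub>*\<close> by a rotation composed with a
  reflection. Hence the product of the two Maxwellians factorises (up to \<open>r\<^bsup>3/2\<^esup>\<close>), and products
  of Hermite polynomials in \<open>v\<close>, \<open>v\<^sub>*\<close> expand, with coefficients \<open>c(r)\<close>, into products of Hermite
  polynomials in \<open>h\<close> and \<open>g\<close>. A collision fixes \<open>h\<close> and \<open>|g|\<close>, so the integrand is a finite sum of
  products of a function of \<open>h\<close> and the \<open>\<gamma>\<close>-integrand in \<open>(g, \<sigma>)\<close>; orthogonality in \<open>h\<close>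
  leaves a single sum. The \<open>\<gamma>\<close> so obtained has its two indices exchanged; it is symmetric in them
  because, in spherical coordinates for \<open>g\<close>, exchanging \<open>g / |g|\<close> and \<open>\<sigma>\<close> preserves the measure
  and the kernel.
\<close>

section \<open>Rotations of Hermite polynomials\<close>

text \<open>The probabilists' Hermite polynomials, generated by the raising operator x - d/dx. This
  is the recursion produced by differentiating p(x) exp(-x^2/2), up to sign, so it matches the
  Rodrigues form of \<open>hermite\<close>.\<close>

primrec hermite_poly :: "nat \<Rightarrow> real poly" where
  "hermite_poly 0 = 1"
| "hermite_poly (Suc n) = [:0, 1:] * hermite_poly n - pderiv (hermite_poly n)"

text \<open>Differentiating the recursion gives one copy of \<open>hermite_poly (Suc n)\<close> from
  the factor x; by induction the remaining terms are Suc n times the recursion one level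
  lower.\<close>

lemma pderiv_hermite_poly_Suc: "pderiv (hermite_poly (Suc n)) = smult (real (Suc n)) (hermite_poly n)"
proof (induction n)
  case 0
  show ?case by (simp add: pderiv_pCons)
next
  case (Suc n)
  have "pderiv (hermite_poly (Suc (Suc n))) = pderiv ([:0, 1:] * hermite_poly (Suc n)) - pderiv (pderiv (hermite_poly (Suc n)))"
    by (simp only: hermite_poly.simps(2)[of "Suc n"] pderiv_diff)
  also have "\<dots> = hermite_poly (Suc n) + [:0, 1:] * smult (real (Suc n)) (hermite_poly n) - smult (real (Suc n)) (pderiv (hermite_poly n))"
    unfolding pderiv_mult Suc by (simp add: pderiv_pCons pderiv_smult del: hermite_poly.simps)
  also have "\<dots> = hermite_poly (Suc n) + smult (real (Suc n)) (hermite_poly (Suc n))"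
    by (simp add: smult_diff_right)
  also have "\<dots> = smult (real (Suc (Suc n))) (hermite_poly (Suc n))"
    using smult_add_left[of 1 "real (Suc n)" "hermite_poly (Suc n)"] by (simp del: hermite_poly.simps)
  finally show ?case .
qed

text \<open>The expansion of (a A + b B)^n evaluated at indices (0, 0), where A raises the first
  index and B the second. The recursive form fits an induction in which one raising operator is
  applied at a time.\<close>

primrec binom_sum :: "real \<Rightarrow> real \<Rightarrow> nat \<Rightarrow> (nat \<Rightarrow> nat \<Rightarrow> real) \<Rightarrow> real" where
  "binom_sum a b 0 f = f 0 0"
| "binom_sum a b (Suc n) f =
     a * binom_sum a b n (\<lambda>s t. f (Suc s) t) + b * binom_sum a b n (\<lambda>s t. f s (Suc t))"

lemma binom_sum_eq:
  "binom_sum a b n f = (\<Sum>s\<le>n. real (n choose s) * a ^ s * b ^ (n - s) * f s (n - s))"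
proof (induction n arbitrary: f)
  case 0
  show ?case by simp
next
  case (Suc n)
  let ?T = "\<lambda>s. a ^ s * b ^ (Suc n - s) * f s (Suc n - s)"
  have 1: "a * (\<Sum>s\<le>n. real (n choose s) * a ^ s * b ^ (n - s) * f (Suc s) (n - s))
      = (\<Sum>s\<le>n. real (n choose s) * ?T (Suc s))"
    by (simp add: sum_distrib_left mult_ac)
  have 2: "b * (\<Sum>s\<le>n. real (n choose s) * a ^ s * b ^ (n - s) * f s (Suc (n - s)))
      = (\<Sum>s\<le>n. real (n choose s) * ?T s)"
    unfolding sum_distrib_left by (rule sum.cong) (auto simp: Suc_diff_le)
  \<comment> \<open>Lengthening the range to \<open>Suc n\<close> adds nothing because n choose
    (n+1) is 0; after the shift, Pascal's rule merges the two sums.\<close>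
  have 3: "(\<Sum>s\<le>n. real (n choose s) * ?T s)
      = ?T 0 + (\<Sum>s\<le>n. real (n choose Suc s) * ?T (Suc s))"
  proof -
    have "(\<Sum>s\<le>n. real (n choose s) * ?T s) = (\<Sum>s\<le>Suc n. real (n choose s) * ?T s)"
      by simp
    also have "\<dots> = ?T 0 + (\<Sum>s\<le>n. real (n choose Suc s) * ?T (Suc s))"
      by (subst sum.atMost_Suc_shift) simp
    finally show ?thesis .
  qed
  have "binom_sum a b (Suc n) f
      = ?T 0 + (\<Sum>s\<le>n. real (Suc n choose Suc s) * ?T (Suc s))"
    by (simp only: binom_sum.simps Suc 1 2 3)
       (simp add: sum.distrib[symmetric] algebra_simps)
  also have "\<dots> = (\<Sum>s\<le>Suc n. real (Suc n choose s) * ?T s)"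
    by (subst sum.atMost_Suc_shift) simp
  finally show ?case by (simp only: mult.assoc)
qed

lemma binom_sum_diff: "binom_sum a b n (\<lambda>s t. f s t - g s t) = binom_sum a b n f - binom_sum a b n g"
  by (simp add: binom_sum_eq sum_subtractf algebra_simps)

lemma binom_sum_cmult: "binom_sum a b n (\<lambda>s t. c * f s t) = c * binom_sum a b n f"
  by (simp add: binom_sum_eq sum_distrib_left algebra_simps)

lemma DERIV_binom_sum:
  assumes "\<And>s t. ((\<lambda>x. f x s t) has_real_derivative D s t) (at x)"
  shows "((\<lambda>x. binom_sum a b n (f x)) has_real_derivative binom_sum a b n D) (at x)"
  unfolding binom_sum_eq by (intro DERIV_sum DERIV_cmult assms)

text \<open>
  Induction on \<open>l\<close> with the raising operator: \<open>H\<^bsub>l+1\<^esub> = (x - d/dx) H\<^sub>l\<close>, and for \<open>x = a W + b G\<close> with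
  \<open>a\<^sup>2 + b\<^sup>2 = 1\<close> this operator is \<open>a (W - \<partial>/\<partial>W) + b (G - \<partial>/\<partial>G)\<close>; here the derivation
  \<open>a \<partial>/\<partial>W + b \<partial>/\<partial>G\<close> annihilates functions of \<open>b W - a G\<close>.
\<close>
lemma hermite_poly_rotation_step:
  fixes a b :: real
  defines "R \<equiv> \<lambda>l k W G. binom_sum a b l (\<lambda>s s'. binom_sum b (- a) k
             (\<lambda>t t'. poly (hermite_poly (s + t)) W * poly (hermite_poly (s' + t')) G))"
  assumes ab: "a\<^sup>2 + b\<^sup>2 = 1"
    and base: "\<And>W G. poly (hermite_poly k) (b * W - a * G) = R 0 k W G"
  shows "poly (hermite_poly l) (a * W + b * G) * poly (hermite_poly k) (b * W - a * G) = R l k W G"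
proof (induction l arbitrary: W G)
  case 0
  show ?case using base by simp
next
  case (Suc l)
  define x where "x = a * W + b * G"
  define y where "y = b * W - a * G"
  let ?l = "poly (hermite_poly l) x" and ?k = "poly (hermite_poly k) y"
  let ?l' = "poly (pderiv (hermite_poly l)) x" and ?k' = "poly (pderiv (hermite_poly k)) y"
  let ?B = "\<lambda>f. binom_sum a b l (\<lambda>s s'. binom_sum b (- a) k (f s s'))"
  \<comment> \<open>The induction hypothesis holds for all W and G, so both of its sides may be
    differentiated in W and, further below, in G.\<close>
  have "((\<lambda>W. poly (hermite_poly l) (a * W + b * G) * poly (hermite_poly k) (b * W - a * G)) has_real_derivative
          a * ?l' * ?k + b * ?l * ?k') (at W)"
    unfolding x_def y_def by (auto intro!: derivative_eq_intros simp: algebra_simps)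
  moreover have "((\<lambda>W. R l k W G) has_real_derivative
      ?B (\<lambda>s s' t t'. poly (pderiv (hermite_poly (s + t))) W * poly (hermite_poly (s' + t')) G)) (at W)"
    unfolding R_def by (intro DERIV_binom_sum) (auto intro!: derivative_eq_intros)
  ultimately have W: "a * ?l' * ?k + b * ?l * ?k' =
      ?B (\<lambda>s s' t t'. poly (pderiv (hermite_poly (s + t))) W * poly (hermite_poly (s' + t')) G)"
    using DERIV_unique unfolding Suc by blast
  have "((\<lambda>G. poly (hermite_poly l) (a * W + b * G) * poly (hermite_poly k) (b * W - a * G)) has_real_derivative
          b * ?l' * ?k - a * ?l * ?k') (at G)"
    unfolding x_def y_def by (auto intro!: derivative_eq_intros simp: algebra_simps)
  moreover have "((\<lambda>G. R l k W G) has_real_derivative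
      ?B (\<lambda>s s' t t'. poly (hermite_poly (s + t)) W * poly (pderiv (hermite_poly (s' + t'))) G)) (at G)"
    unfolding R_def by (intro DERIV_binom_sum) (auto intro!: derivative_eq_intros)
  ultimately have G: "b * ?l' * ?k - a * ?l * ?k' =
      ?B (\<lambda>s s' t t'. poly (hermite_poly (s + t)) W * poly (pderiv (hermite_poly (s' + t'))) G)"
    using DERIV_unique unfolding Suc by blast
  have F: "?l * ?k = ?B (\<lambda>s s' t t'. poly (hermite_poly (s + t)) W * poly (hermite_poly (s' + t')) G)"
    using Suc[of W G] unfolding x_def y_def R_def .
  \<comment> \<open>Raising s by one applies W - d/dW under the sum; in \<open>2\<close>, raising s'
    applies G - d/dG.\<close>
  have 1: "?B (\<lambda>s s' t t'. poly (hermite_poly (Suc s + t)) W * poly (hermite_poly (s' + t')) G) =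
      W * (?l * ?k) - (a * ?l' * ?k + b * ?l * ?k')"
    unfolding W F by (simp add: binom_sum_diff binom_sum_cmult algebra_simps)
  have 2: "?B (\<lambda>s s' t t'. poly (hermite_poly (s + t)) W * poly (hermite_poly (Suc s' + t')) G) =
      G * (?l * ?k) - (b * ?l' * ?k - a * ?l * ?k')"
    unfolding G F by (simp add: binom_sum_diff binom_sum_cmult algebra_simps)
  have "R (Suc l) k W G = a * (W * (?l * ?k) - (a * ?l' * ?k + b * ?l * ?k'))
      + b * (G * (?l * ?k) - (b * ?l' * ?k - a * ?l * ?k'))"
    unfolding R_def binom_sum.simps 1 2 ..
  \<comment> \<open>The terms with \<open>?k'\<close> cancel, having coefficients -a b and b
    a.\<close>
  also have "\<dots> = x * ?l * ?k - (a\<^sup>2 + b\<^sup>2) * ?l' * ?k"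
    unfolding x_def by (simp add: algebra_simps power2_eq_square)
  also have "\<dots> = poly (hermite_poly (Suc l)) x * ?k"
    unfolding ab by (simp add: algebra_simps)
  finally show ?case unfolding x_def y_def ..
qed

text \<open>The rotation step with second degree 0, where its base hypothesis is trivial.\<close>

lemma hermite_poly_add:
  assumes "a\<^sup>2 + b\<^sup>2 = 1"
  shows "poly (hermite_poly n) (a * W + b * G) = binom_sum a b n (\<lambda>s t. poly (hermite_poly s) W * poly (hermite_poly t) G)"
  using hermite_poly_rotation_step[OF assms, of 0 n W G] by simp

text \<open>The base hypothesis of the step is the addition formula for the pair (b, -a), which is
  again a unit vector.\<close>

lemma hermite_poly_rotation:
  assumes "a\<^sup>2 + b\<^sup>2 = 1"
  shows "poly (hermite_poly l) (a * W + b * G) * poly (hermite_poly k) (b * W - a * G) =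
    binom_sum a b l (\<lambda>s s'. binom_sum b (- a) k
      (\<lambda>t t'. poly (hermite_poly (s + t)) W * poly (hermite_poly (s' + t')) G))"
proof (rule hermite_poly_rotation_step[OF assms])
  have "b\<^sup>2 + (- a)\<^sup>2 = 1" using assms by (simp add: add.commute)
  from hermite_poly_add[OF this] show "poly (hermite_poly k) (b * W - a * G) =
    binom_sum a b 0 (\<lambda>s s'. binom_sum b (- a) k
      (\<lambda>t t'. poly (hermite_poly (s + t)) W * poly (hermite_poly (s' + t')) G))" for W G
    by (simp add: algebra_simps)
qed

text \<open>Collecting the double binomial sum by the total degree l' = s + t in W turns the
  coefficient into a convolution; inserting a and b as half-integer powers of 1 + r and r gives
  \<open>ccoef\<close>.\<close>

lemma hermite_poly_rotation_ccoef:
  fixes r W G :: real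
  assumes r: "r > 0"
  defines "a \<equiv> 1 / sqrt (1 + r)" and "b \<equiv> sqrt (r / (1 + r))"
  shows "poly (hermite_poly l) (a * W + b * G) * poly (hermite_poly k) (b * W - a * G) =
    (\<Sum>l'\<le>l + k. ccoef l k l' (l + k - l') r * poly (hermite_poly l') W * poly (hermite_poly (l + k - l')) G)"
proof -
  have ab: "a\<^sup>2 + b\<^sup>2 = 1"
    using r by (simp add: a_def b_def power_divide field_simps)
  have half: "sqrt x ^ n = x powr (real n / 2)" if "x > 0" for x :: real and n
    using that by (simp add: powr_half_sqrt[symmetric] powr_realpow[symmetric] powr_powr)
  have apow: "a ^ n = (1 + r) powr (- real n / 2)" for n
    using r by (simp add: a_def power_divide half powr_minus_divide)
  have bpow: "b ^ n = r powr (real n / 2) * (1 + r) powr (- real n / 2)" for n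
    using r by (simp add: b_def real_sqrt_divide power_divide half powr_minus_divide)
  define T where "T s l' = real (l choose s) * a ^ s * b ^ (l - s) *
     (real (k choose (l' - s)) * b ^ (l' - s) * (- a) ^ (k - (l' - s)))" for s l'
  define h where "h l' = poly (hermite_poly l') W * poly (hermite_poly (l + k - l')) G" for l'
  have "poly (hermite_poly l) (a * W + b * G) * poly (hermite_poly k) (b * W - a * G) =
     (\<Sum>s\<le>l. \<Sum>t\<le>k. T s (s + t) * h (s + t))"
    unfolding hermite_poly_rotation[OF ab] binom_sum_eq T_def h_def
    by (intro sum.cong refl) (auto simp: sum_distrib_left mult_ac intro!: sum.cong)
  \<comment> \<open>The inner index t is replaced by l' = s + t over a range independent of s,
    padded with zeros, so that the sums can be swapped.\<close>
  also have "\<dots> = (\<Sum>s\<le>l. \<Sum>l'\<le>l + k. if s \<le> l' \<and> l' \<le> s + k then T s l' * h l' else 0)"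
  proof (rule sum.cong[OF refl])
    fix s assume s: "s \<in> {..l}"
    have "(\<Sum>t\<le>k. T s (s + t) * h (s + t)) = (\<Sum>l'\<in>{s..s + k}. T s l' * h l')"
      by (rule sum.reindex_bij_witness[of _ "\<lambda>l'. l' - s" "\<lambda>t. s + t"]) auto
    also have "\<dots> = (\<Sum>l'\<le>l + k. if s \<le> l' \<and> l' \<le> s + k then T s l' * h l' else 0)"
      using s by (subst sum.inter_filter[symmetric]) (auto intro!: sum.cong)
    finally show "(\<Sum>t\<le>k. T s (s + t) * h (s + t)) =
       (\<Sum>l'\<le>l + k. if s \<le> l' \<and> l' \<le> s + k then T s l' * h l' else 0)" .
  qed
  also have "\<dots> = (\<Sum>l'\<le>l + k. (\<Sum>s\<le>l. if s \<le> l' \<and> l' \<le> s + k then T s l' else 0) * h l')"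
    by (subst sum.swap) (auto simp: sum_distrib_right intro!: sum.cong)
  also have "\<dots> = (\<Sum>l'\<le>l + k. ccoef l k l' (l + k - l') r * h l')"
  proof (rule sum.cong[OF refl])
    fix l' assume l': "l' \<in> {..l + k}"
    have "ccoef l k l' (l + k - l') r = (\<Sum>s\<le>l. (1 + r) powr (- (real l' + real (l + k - l')) / 2) *
       (binomZ l (int s) * binomZ k (int l' - int s)
        * (-1) powi (int k - int l' + int s) * r powr ((real l + real l') / 2 - real s)))"
      unfolding ccoef_def sum_distrib_left
      by (rule sum.reindex_bij_witness[of _ int nat]) auto
    also have "\<dots> = (\<Sum>s\<le>l. if s \<le> l' \<and> l' \<le> s + k then T s l' else 0)"
    proof (rule sum.cong[OF refl])
      fix s assume s: "s \<in> {..l}"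
      show "(1 + r) powr (- (real l' + real (l + k - l')) / 2) *
        (binomZ l (int s) * binomZ k (int l' - int s)
        * (-1) powi (int k - int l' + int s) * r powr ((real l + real l') / 2 - real s))
        = (if s \<le> l' \<and> l' \<le> s + k then T s l' else 0)"
      proof (cases "s \<le> l' \<and> l' \<le> s + k")
        case True
        \<comment> \<open>With l' = s + t, l = s + u and k = t + v all truncated subtractions
          disappear: 1 + r gets exponent -(s+t+u+v)/2, r gets (t+u)/2, and the sign is
          (-1)^v.\<close>
        then obtain t where t: "l' = s + t" "t \<le> k" by (metis le_iff_add add_le_cancel_left)
        obtain u where u: "l = s + u" using s by (auto simp: le_iff_add)
        obtain v where v: "k = t + v" using t by (auto simp: le_iff_add)
        have pw: "(-1::real) powi (int k - int l' + int s) = (-1) ^ v"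
          by (simp add: t(1) v)
        have am: "(-a) ^ v = (-1) ^ v * a ^ v" by (rule power_minus)
        have e: "(real l + real l') / 2 - real s = real u / 2 + real t / 2"
          by (simp add: t(1) u add_divide_distrib)
        have e2: "(1 + r) powr (- (real l' + real (l + k - l')) / 2) =
           (1 + r) powr (- real s / 2) * (1 + r) powr (- real u / 2) * (1 + r) powr (- real t / 2) * (1 + r) powr (- real v / 2)"
          unfolding powr_add[symmetric]
          by (rule arg_cong[of _ _ "\<lambda>x. (1 + r) powr x"]) (simp add: t(1) u v add_divide_distrib diff_divide_distrib)
        have T: "T s l' = real (l choose s) * real (k choose t) * (-1) ^ v *
            (a ^ s * b ^ u * b ^ t * a ^ v)"
          by (simp add: T_def t(1) u v am)
        have B: "binomZ l (int s) = real (l choose s)" "binomZ k (int l' - int s) = real (k choose t)"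
          using s t by (auto simp: binomZ_def)
        have "(if s \<le> l' \<and> l' \<le> s + k then T s l' else 0) = T s l'"
          using True by simp
        then show ?thesis
          unfolding pw e e2 T B apow bpow powr_add by (simp only: mult_ac)
      next
        case False
        \<comment> \<open>Outside the range both sides vanish: the padding on one side, the zero
          convention for binomials on the other.\<close>
        then have "binomZ k (int l' - int s) = 0" by (auto simp: binomZ_def)
        then show ?thesis by (simp only: False if_False mult_zero_left mult_zero_right)
      qed
    qed
    finally show "(\<Sum>s\<le>l. if s \<le> l' \<and> l' \<le> s + k then T s l' else 0) * h l'
      = ccoef l k l' (l + k - l') r * h l'" by simp
  qed
  finally show ?thesis by (simp add: h_def mult_ac)
qed

section \<open>Gaussian orthogonality\<close>

lemma borel_measurable_vec_lambda:
  fixes f :: "'n::finite \<Rightarrow> 'a \<Rightarrow> real"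
  assumes "\<And>i. f i \<in> borel_measurable M"
  shows "(\<lambda>x. \<chi> i. f i x) \<in> borel_measurable M"
proof -
  have "(\<lambda>x. \<chi> i. f i x) = (\<lambda>x. \<Sum>i\<in>UNIV. f i x *\<^sub>R axis i 1)"
    by (auto simp: vec_eq_iff axis_def if_distrib[of "(*) _"] cong: if_cong)
  then show ?thesis using assms by simp
qed

lemma prod_Basis_cart:
  fixes x :: "real^'n::finite"
  shows "(\<Prod>b\<in>Basis. x \<bullet> b) = (\<Prod>i\<in>UNIV. x $ i)"
proof -
  have B: "(Basis :: (real^'n) set) = range (\<lambda>i. axis i 1)" by (auto simp: Basis_vec_def)
  have inj: "inj (\<lambda>i::'n. axis i (1::real))" by (auto simp: inj_on_def axis_eq_axis)
  show ?thesis unfolding B prod.reindex[OF inj] by (simp add: inner_axis)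
qed

text \<open>Lebesgue measure is determined by its values on boxes, and the preimage of a box under
  \<open>vec_lambda\<close> is a product of intervals. This carries Fubini for finite product
  measures over to \<open>real^'n\<close>.\<close>

lemma lborel_vec_eq:
  "(lborel :: (real^'n::finite) measure) = distr (\<Pi>\<^sub>M i\<in>UNIV. lborel) borel (\<lambda>f. \<chi> i. f i)"
proof (rule lborel_eqI)
  interpret product_sigma_finite "\<lambda>_::'n. lborel :: real measure" by standard
  have m: "(\<lambda>f. \<chi> i. f i) \<in> borel_measurable (\<Pi>\<^sub>M i\<in>(UNIV::'n set). (lborel :: real measure))"
    by (rule borel_measurable_vec_lambda) simp
  fix l u :: "real^'n" assume le: "\<And>b. b \<in> Basis \<Longrightarrow> l \<bullet> b \<le> u \<bullet> b"
  have le': "l $ i \<le> u $ i" for i using le[of "axis i 1"] by (simp add: inner_axis)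
  have "(\<lambda>f. \<chi> i. f i) -` box l u \<inter> space (\<Pi>\<^sub>M i\<in>(UNIV::'n set). (lborel :: real measure))
     = (\<Pi>\<^sub>E i\<in>UNIV. {l $ i <..< u $ i})"
    by (auto simp: mem_box_cart space_PiM PiE_def Pi_iff)
  then show "emeasure (distr (\<Pi>\<^sub>M i\<in>UNIV. lborel) borel (\<lambda>f. \<chi> i. f i)) (box l u) =
     ennreal (\<Prod>b\<in>Basis. (u - l) \<bullet> b)"
    by (simp add: emeasure_distr[OF m] emeasure_PiM le' prod_ennreal prod_Basis_cart)
qed simp

lemma
  fixes f :: "'n::finite \<Rightarrow> real \<Rightarrow> real"
  assumes f: "\<And>i. integrable lborel (f i)"
  shows integrable_prod_cart: "integrable lborel (\<lambda>x::real^'n. \<Prod>i\<in>UNIV. f i (x $ i))"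
    and integral_prod_cart: "(LINT x|lborel. (\<Prod>i\<in>UNIV. f i ((x::real^'n) $ i))) = (\<Prod>i\<in>UNIV. LINT x|lborel. f i x)"
proof -
  interpret product_sigma_finite "\<lambda>_::'n. lborel :: real measure" by standard
  have m: "(\<lambda>f. \<chi> i. f i) \<in> borel_measurable (\<Pi>\<^sub>M i\<in>(UNIV::'n set). (lborel :: real measure))"
    by (rule borel_measurable_vec_lambda) simp
  have [measurable]: "f i \<in> borel_measurable borel" for i
    using f[of i] by (auto dest: borel_measurable_integrable)
  show "integrable lborel (\<lambda>x::real^'n. \<Prod>i\<in>UNIV. f i (x $ i))"
    by (subst lborel_vec_eq, subst integrable_distr_eq[OF m])
       (auto intro!: product_integrable_prod f)
  show "(LINT x|lborel. (\<Prod>i\<in>UNIV. f i ((x::real^'n) $ i))) = (\<Prod>i\<in>UNIV. LINT x|lborel. f i x)"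
    by (subst lborel_vec_eq, subst integral_distr[OF m])
       (auto intro!: product_integral_prod f)
qed

section \<open>Moments of the standard normal density and orthogonality of Hermite
  polynomials\<close>

lemma integrable_poly_std_normal: "integrable lborel (\<lambda>x. poly p x * std_normal_density x)"
proof -
  have "(\<lambda>x. poly p x * std_normal_density x) = (\<lambda>x. \<Sum>i\<le>degree p. coeff p i * (std_normal_density x * x ^ i))"
    unfolding poly_altdef sum_distrib_right by (intro ext sum.cong) auto
  then show ?thesis by (simp add: integrable_std_normal_moment)
qed

text \<open>The expectation under the standard normal law, as a functional on polynomials, so that
  linearity holds without integrability side conditions.\<close>

definition gauss_mean :: "real poly \<Rightarrow> real" where
  "gauss_mean p = (LINT x|lborel. poly p x * std_normal_density x)"

lemma gauss_mean_diff: "gauss_mean (p - q) = gauss_mean p - gauss_mean q"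
  by (simp add: gauss_mean_def left_diff_distrib integrable_poly_std_normal)

lemma gauss_mean_add: "gauss_mean (p + q) = gauss_mean p + gauss_mean q"
  by (simp add: gauss_mean_def distrib_right integrable_poly_std_normal)

lemma gauss_mean_smult: "gauss_mean (smult c p) = c * gauss_mean p"
  by (simp add: gauss_mean_def mult.assoc integrable_poly_std_normal)

lemma gauss_mean_sum: "gauss_mean (sum p A) = (\<Sum>i\<in>A. gauss_mean (p i))"
  by (cases "finite A") (simp_all add: gauss_mean_def poly_sum sum_distrib_right integrable_poly_std_normal)

lemma gauss_mean_monom_odd: "odd n \<Longrightarrow> gauss_mean (monom 1 n) = 0"
  using integral_std_normal_moment_odd
  by (auto simp: gauss_mean_def poly_monom mult.commute elim!: oddE)

lemma gauss_mean_monom_even: "gauss_mean (monom 1 (2 * k)) = fact (2 * k) / (2 ^ k * fact k)"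
  using integral_std_normal_moment_even[of k]
  by (simp add: gauss_mean_def poly_monom mult.commute)

lemma gauss_mean_1: "gauss_mean 1 = 1"
  using gauss_mean_monom_even[of 0] by simp

lemma gauss_mean_monom_Suc: "gauss_mean (monom 1 (Suc n)) = real n * gauss_mean (monom 1 (n - 1))"
proof (cases "even n")
  case True
  \<comment> \<open>At n = 0 the truncated \<open>n - 1\<close> is harmless because of the factor n;
    otherwise both moments are odd.\<close>
  then show ?thesis by (cases "n = 0") (simp_all add: gauss_mean_monom_odd)
next
  case False
  then obtain k where n: "n = 2 * k + 1" by (elim oddE)
  have "gauss_mean (monom 1 (Suc n)) = fact (2 * Suc k) / (2 ^ Suc k * fact (Suc k))"
    using gauss_mean_monom_even[of "Suc k"] by (simp add: n)
  also have "\<dots> = real n * (fact (2 * k) / (2 ^ k * fact k))"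
    by (simp add: n divide_simps)
  finally show ?thesis by (simp add: n gauss_mean_monom_even)
qed

text \<open>Gaussian integration by parts, obtained by linearity from the recursion for the moments,
  so no boundary terms arise.\<close>

lemma gauss_mean_mult_X: "gauss_mean ([:0, 1:] * p) = gauss_mean (pderiv p)"
proof -
  have X: "[:0, 1:] * monom c n = monom c (Suc n)" for c :: real and n
    by (simp add: monom_Suc)
  have "[:0, 1:] * p = [:0, 1:] * (\<Sum>i\<le>degree p. monom (coeff p i) i)"
    by (simp only: poly_as_sum_of_monoms)
  also have "\<dots> = (\<Sum>i\<le>degree p. smult (coeff p i) (monom 1 (Suc i)))"
    by (simp only: sum_distrib_left X) (simp add: smult_monom)
  finally have "[:0, 1:] * p = (\<Sum>i\<le>degree p. smult (coeff p i) (monom 1 (Suc i)))" .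
  moreover have "pderiv p = (\<Sum>i\<le>degree p. smult (coeff p i) (smult (real i) (monom 1 (i - 1))))"
    using higher_pderiv_sum[of 1 "\<lambda>i. monom (coeff p i) i" "{..degree p}"]
    by (simp add: poly_as_sum_of_monoms pderiv_monom smult_monom mult.commute)
  ultimately show ?thesis
    by (simp add: gauss_mean_sum gauss_mean_smult gauss_mean_monom_Suc mult.assoc del: mult_pCons_left)
qed

text \<open>The raising operator x - d/dx is the adjoint of d/dx for the Gaussian weight.\<close>

lemma gauss_mean_hermite_poly_Suc_mult: "gauss_mean (hermite_poly (Suc m) * q) = gauss_mean (hermite_poly m * pderiv q)"
proof -
  have "hermite_poly (Suc m) * q = [:0, 1:] * (hermite_poly m * q) - pderiv (hermite_poly m) * q"
    by (simp add: algebra_simps del: mult_pCons_left)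
  then have "gauss_mean (hermite_poly (Suc m) * q) = gauss_mean (pderiv (hermite_poly m * q)) - gauss_mean (pderiv (hermite_poly m) * q)"
    by (simp only: gauss_mean_diff gauss_mean_mult_X)
  then show ?thesis
    by (simp add: pderiv_mult gauss_mean_add mult.commute)
qed

text \<open>Each use of the adjointness lowers both degrees by one and contributes a factor from the
  derivative of the second polynomial; a constant reached too early is differentiated to 0.\<close>

lemma gauss_mean_hermite_poly_mult: "gauss_mean (hermite_poly m * hermite_poly n) = (if m = n then fact n else 0)"
proof (induction m arbitrary: n)
  case 0
  show ?case
  proof (cases n)
    case (Suc k)
    have "gauss_mean (hermite_poly (Suc k) * 1) = gauss_mean (hermite_poly k * pderiv 1)"
      by (rule gauss_mean_hermite_poly_Suc_mult)
    then show ?thesis by (simp add: Suc gauss_mean_def del: hermite_poly.simps(2))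
  qed (simp add: gauss_mean_1)
next
  case (Suc m)
  show ?case
  proof (cases n)
    case 0
    have "gauss_mean (hermite_poly (Suc m) * 1) = gauss_mean (hermite_poly m * pderiv 1)"
      by (rule gauss_mean_hermite_poly_Suc_mult)
    then show ?thesis by (simp add: 0 gauss_mean_def del: hermite_poly.simps(2))
  next
    case (Suc k)
    then show ?thesis
      by (simp add: gauss_mean_hermite_poly_Suc_mult pderiv_hermite_poly_Suc gauss_mean_smult Suc.IH del: hermite_poly.simps(2))
  qed
qed

section \<open>Maxwellian and Hermite functions as products over the coordinates\<close>

lemma norm_cart_power2: "(norm (x :: real^'n::finite))\<^sup>2 = (\<Sum>i\<in>UNIV. (x $ i)\<^sup>2)"
  by (simp only: power2_norm_eq_inner inner_vec_def) (simp add: power2_eq_square)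

lemma maxwellian_pos: "T > 0 \<Longrightarrow> maxwellian u T v > 0"
  by (simp add: maxwellian_def)

lemma maxwellian_0_prod:
  assumes T: "T > 0"
  shows "maxwellian 0 T v = (\<Prod>i\<in>UNIV. std_normal_density (v $ i / sqrt T) / sqrt T)"
proof -
  have "std_normal_density (x / sqrt T) / sqrt T = (2 * pi * T) powr (-1/2) * exp (- (x\<^sup>2) / (2 * T))" for x
    using T by (simp add: std_normal_density_def power_divide powr_minus_divide powr_half_sqrt real_sqrt_mult)
  then have "(\<Prod>i\<in>UNIV. std_normal_density (v $ i / sqrt T) / sqrt T)
      = ((2 * pi * T) powr (-1/2)) ^ 3 * exp (\<Sum>i\<in>UNIV. - ((v $ i)\<^sup>2) / (2 * T))"
    by (simp only: prod.distrib prod_constant exp_sum[OF finite] card_num1 card_bit1) simp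
  also have "((2 * pi * T) powr (-1/2)) ^ 3 = (2 * pi * T) powr (-3/2)"
    using T by (subst powr_power) auto
  finally show ?thesis
    by (simp add: maxwellian_def norm_cart_power2 sum_divide_distrib sum_negf)
qed

text \<open>The factor \<open>C\<close> stands for everything that is constant along axis i, in
  particular the polynomials in the other coordinates. Writing the temperature as
  \<open>s\<^sup>2\<close> keeps the inner derivative equal to 1 / s.\<close>

lemma partial_mult_maxwellian:
  fixes p :: "real poly"
  assumes s: "s > 0" and C: "\<And>v t. C (v + t *\<^sub>R axis i 1) = C v"
  shows "partial i (\<lambda>v. C v * poly p (v $ i / s) * maxwellian 0 (s\<^sup>2) v)
    = (\<lambda>v. - (1 / s) * C v * poly ([:0, 1:] * p - pderiv p) (v $ i / s) * maxwellian 0 (s\<^sup>2) v)"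
proof
  fix v
  let ?e = "axis i 1 :: real^3"
  have N: "(norm (v + t *\<^sub>R ?e))\<^sup>2 = (norm v)\<^sup>2 + 2 * t * v $ i + t\<^sup>2" for t
    by (simp only: power2_norm_eq_inner) (simp add: inner_add_left inner_add_right inner_axis inner_axis' power2_eq_square algebra_simps)
  have "((\<lambda>t. C (v + t *\<^sub>R ?e) * poly p ((v + t *\<^sub>R ?e) $ i / s) * maxwellian 0 (s\<^sup>2) (v + t *\<^sub>R ?e))
     has_real_derivative (- (1 / s) * C v * poly ([:0, 1:] * p - pderiv p) (v $ i / s) * maxwellian 0 (s\<^sup>2) v)) (at 0)"
    unfolding C maxwellian_def diff_zero N using s
    by (auto intro!: derivative_eq_intros simp: axis_def field_simps power2_eq_square)
  then show "partial i (\<lambda>v. C v * poly p (v $ i / s) * maxwellian 0 (s\<^sup>2) v) v =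
     - (1 / s) * C v * poly ([:0, 1:] * p - pderiv p) (v $ i / s) * maxwellian 0 (s\<^sup>2) v"
    unfolding partial_def by (rule DERIV_imp_deriv)
qed

lemma partial_funpow_maxwellian:
  assumes s: "s > 0" and C: "\<And>v t. C (v + t *\<^sub>R axis i 1) = C v"
  shows "(partial i ^^ n) (\<lambda>v. C v * maxwellian 0 (s\<^sup>2) v)
    = (\<lambda>v. (- (1 / s)) ^ n * C v * poly (hermite_poly n) (v $ i / s) * maxwellian 0 (s\<^sup>2) v)"
proof (induction n)
  case (Suc n)
  have "(partial i ^^ Suc n) (\<lambda>v. C v * maxwellian 0 (s\<^sup>2) v)
     = partial i (\<lambda>v. ((- (1 / s)) ^ n * C v) * poly (hermite_poly n) (v $ i / s) * maxwellian 0 (s\<^sup>2) v)"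
    using Suc by simp
  also have "\<dots> = (\<lambda>v. - (1 / s) * ((- (1 / s)) ^ n * C v) * poly ([:0, 1:] * hermite_poly n - pderiv (hermite_poly n)) (v $ i / s) * maxwellian 0 (s\<^sup>2) v)"
    by (rule partial_mult_maxwellian) (simp_all add: s C)
  finally show ?case by (simp add: mult_ac)
qed simp

text \<open>The derivatives are taken along axes 3, 2, 1 in turn; the polynomial factors already
  produced serve as the constant \<open>C\<close> for the next axis.\<close>

lemma hermite_eq_prod:
  assumes T: "T > 0"
  shows "hermite 0 T a v = (\<Prod>i\<in>UNIV. poly (hermite_poly (a $ i)) (v $ i / sqrt T))"
proof -
  define s where "s = sqrt T"
  have s: "s > 0" and T_eq: "T = s\<^sup>2" using T by (auto simp: s_def)
  have "(partial 3 ^^ (a$3)) (maxwellian 0 (s\<^sup>2))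
     = (\<lambda>v. ((- (1 / s)) ^ a$3 * poly (hermite_poly (a$3)) (v $ 3 / s)) * maxwellian 0 (s\<^sup>2) v)"
    using partial_funpow_maxwellian[OF s, of "\<lambda>_. 1" 3 "a$3"] by simp
  then have "(partial 2 ^^ (a$2)) ((partial 3 ^^ (a$3)) (maxwellian 0 (s\<^sup>2)))
     = (\<lambda>v. ((- (1 / s)) ^ a$2 * ((- (1 / s)) ^ a$3 * poly (hermite_poly (a$3)) (v $ 3 / s))
          * poly (hermite_poly (a$2)) (v $ 2 / s)) * maxwellian 0 (s\<^sup>2) v)"
    by (simp only:, subst partial_funpow_maxwellian[OF s]) (simp_all add: axis_def)
  then have "mderiv a (maxwellian 0 (s\<^sup>2))
     = (\<lambda>v. (- (1 / s)) ^ a$1 * ((- (1 / s)) ^ a$2 * ((- (1 / s)) ^ a$3 * poly (hermite_poly (a$3)) (v $ 3 / s))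
          * poly (hermite_poly (a$2)) (v $ 2 / s)) * poly (hermite_poly (a$1)) (v $ 1 / s) * maxwellian 0 (s\<^sup>2) v)"
    unfolding mderiv_def by (simp only:, subst partial_funpow_maxwellian[OF s]) (simp_all add: axis_def)
  from fun_cong[OF this, of v] have D: "mderiv a (maxwellian 0 T) v = (- (1 / s)) ^ mabs a *
      (\<Prod>i\<in>UNIV. poly (hermite_poly (a $ i)) (v $ i / s)) * maxwellian 0 T v"
    unfolding T_eq[symmetric] by (simp only: mabs_def power_add UNIV_3) (simp add: mult_ac)
  have "T powr (real (mabs a) / 2) = s ^ mabs a"
    using T by (simp add: s_def powr_half_sqrt[symmetric] powr_realpow[symmetric] powr_powr)
  \<comment> \<open>The normalisation in \<open>hermite\<close> exactly undoes the factors -1/s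
    collected by the derivatives.\<close>
  then have "(-1) ^ mabs a * T powr (real (mabs a) / 2) * (- (1 / s)) ^ mabs a = 1"
    using s by (simp only: power_mult_distrib[symmetric]) simp
  moreover have "maxwellian 0 T v \<noteq> 0" using maxwellian_pos[OF T, of 0 v] by simp
  ultimately show ?thesis
    unfolding hermite_def D s_def[symmetric] by (simp add: field_simps)
qed

section \<open>Spherical coordinates\<close>

lemma emeasure_box_cart:
  fixes l u :: "real^'n::finite"
  assumes "\<And>i. l $ i \<le> u $ i"
  shows "emeasure lborel (box l u) = ennreal (\<Prod>i\<in>UNIV. u $ i - l $ i)"
proof -
  have "emeasure lborel (box l u) = ennreal (\<Prod>b\<in>Basis. (u - l) \<bullet> b)"
    by (rule emeasure_lborel_box) (use assms in \<open>auto simp: Basis_vec_def inner_axis\<close>)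
  then show ?thesis by (simp add: prod_Basis_cart)
qed

text \<open>By Tonelli the measure of a preimage is the integral of the measures of its slices, and
  each slice is a preimage under the measure-preserving \<open>t x\<close>.\<close>

lemma lborel_distr_fibre_snd:
  fixes t :: "'a::euclidean_space \<Rightarrow> 'b::euclidean_space \<Rightarrow> 'b"
  assumes m: "(\<lambda>(x, y). t x y) \<in> borel_measurable borel"
    and t: "\<And>x. distr lborel borel (t x) = lborel"
  shows "distr lborel borel (\<lambda>(x, y). (x, t x y)) = (lborel :: ('a \<times> 'b) measure)"
proof (rule measure_eqI)
  have m': "(\<lambda>(x, y). t x y) \<in> borel_measurable (borel \<Otimes>\<^sub>M borel)" using m by (simp add: borel_prod)
  have T: "(\<lambda>(x, y). (x, t x y)) \<in> borel_measurable (borel :: ('a \<times> 'b) measure)"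
    unfolding borel_prod[symmetric] using m' by (auto simp: measurable_split_conv intro!: measurable_Pair)
  have mt: "t x \<in> borel_measurable borel" for x
    using measurable_compose[OF measurable_Pair1' m', of x] by simp
  fix A :: "('a \<times> 'b) set"
  assume "A \<in> sets (distr lborel borel (\<lambda>(x, y). (x, t x y)))"
  then have A: "A \<in> sets borel" by simp
  have A': "A \<in> sets (lborel \<Otimes>\<^sub>M lborel)" using A by (simp only: lborel_prod sets_lborel)
  have AT: "(\<lambda>(x, y). (x, t x y)) -` A \<in> sets (lborel \<Otimes>\<^sub>M lborel)"
    unfolding lborel_prod sets_lborel using measurable_sets[OF T A] by simp
  have Ax: "Pair x -` A \<in> sets borel" for x
    using sets_Pair1[OF A', of x] by simp
  have "emeasure (distr lborel borel (\<lambda>(x, y). (x, t x y))) A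
      = emeasure (lborel \<Otimes>\<^sub>M lborel) ((\<lambda>(x, y). (x, t x y)) -` A)"
    using T A by (simp add: emeasure_distr lborel_prod)
  also have "\<dots> = (\<integral>\<^sup>+x. emeasure lborel (t x -` (Pair x -` A)) \<partial>lborel)"
    by (subst lborel.emeasure_pair_measure_alt[OF AT]) (auto intro!: nn_integral_cong arg_cong[of _ _ "emeasure lborel"])
  also have "\<dots> = (\<integral>\<^sup>+x. emeasure (distr lborel borel (t x)) (Pair x -` A) \<partial>lborel)"
    using mt Ax by (simp add: emeasure_distr)
  also have "\<dots> = emeasure lborel A"
    unfolding t lborel_prod[symmetric] by (simp add: lborel.emeasure_pair_measure_alt[OF A'])
  finally show "emeasure (distr lborel borel (\<lambda>(x, y). (x, t x y))) A = emeasure lborel A" .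
qed simp

lemma lborel_distr_fibre_fst:
  fixes t :: "'b::euclidean_space \<Rightarrow> 'a::euclidean_space \<Rightarrow> 'a"
  assumes m: "(\<lambda>(y, x). t y x) \<in> borel_measurable borel"
    and t: "\<And>y. distr lborel borel (t y) = lborel"
  shows "distr lborel borel (\<lambda>(x, y). (t y x, y)) = (lborel :: ('a \<times> 'b) measure)"
proof (rule measure_eqI)
  have m': "(\<lambda>(y, x). t y x) \<in> borel_measurable (borel \<Otimes>\<^sub>M borel)" using m by (simp add: borel_prod)
  have "(\<lambda>(x, y). t y x) \<in> borel_measurable (borel \<Otimes>\<^sub>M borel)"
    using measurable_compose[OF measurable_pair_swap' m'] by (simp add: case_prod_beta')
  then have T: "(\<lambda>(x, y). (t y x, y)) \<in> borel_measurable (borel :: ('a \<times> 'b) measure)"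
    unfolding borel_prod[symmetric] by (auto simp: measurable_split_conv intro!: measurable_Pair)
  have mt: "t y \<in> borel_measurable borel" for y
    using measurable_compose[OF measurable_Pair1' m', of y] by simp
  fix A :: "('a \<times> 'b) set"
  assume "A \<in> sets (distr lborel borel (\<lambda>(x, y). (t y x, y)))"
  then have A: "A \<in> sets borel" by simp
  have A': "A \<in> sets (lborel \<Otimes>\<^sub>M lborel)" using A by (simp only: lborel_prod sets_lborel)
  have AT: "(\<lambda>(x, y). (t y x, y)) -` A \<in> sets (lborel \<Otimes>\<^sub>M lborel)"
    unfolding lborel_prod sets_lborel using measurable_sets[OF T A] by simp
  have Ay: "(\<lambda>x. (x, y)) -` A \<in> sets borel" for y
    using sets_Pair2[OF A', of y] by simp
  have "emeasure (distr lborel borel (\<lambda>(x, y). (t y x, y))) A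
      = emeasure (lborel \<Otimes>\<^sub>M lborel) ((\<lambda>(x, y). (t y x, y)) -` A)"
    using T A by (simp add: emeasure_distr lborel_prod)
  also have "\<dots> = (\<integral>\<^sup>+y. emeasure lborel (t y -` ((\<lambda>x. (x, y)) -` A)) \<partial>lborel)"
    by (subst lborel_pair.emeasure_pair_measure_alt2[OF AT]) (auto intro!: nn_integral_cong arg_cong[of _ _ "emeasure lborel"])
  also have "\<dots> = (\<integral>\<^sup>+y. emeasure (distr lborel borel (t y)) ((\<lambda>x. (x, y)) -` A) \<partial>lborel)"
    using mt Ay by (simp add: emeasure_distr)
  also have "\<dots> = emeasure lborel A"
    unfolding t lborel_prod[symmetric] by (simp add: lborel_pair.emeasure_pair_measure_alt2[OF A'])
  finally show "emeasure (distr lborel borel (\<lambda>(x, y). (t y x, y))) A = emeasure lborel A" .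
qed simp

lemma lborel_distr_minus_left: "distr lborel borel (\<lambda>x. c - x) = (lborel :: 'a::euclidean_space measure)"
proof -
  have "(lborel :: 'a measure) = density (distr lborel borel (\<lambda>x. c + (-1) *\<^sub>R x)) (\<lambda>_. ennreal (\<bar>-1\<bar> ^ DIM('a)))"
    by (rule lborel_affine) simp
  then show ?thesis by (simp add: density_1)
qed

section \<open>The spherical coordinate map: Jacobian, injectivity, range and change of
  variables\<close>

definition spherical :: "real^3 \<Rightarrow> real^3" where
  "spherical x = x $ 1 *\<^sub>R sph (x $ 2, x $ 3)"

definition spherical_deriv :: "real^3 \<Rightarrow> real^3 \<Rightarrow> real^3" where
  "spherical_deriv x h = (\<chi> i.
     if i = 1 then h $ 1 * (sin (x $ 2) * cos (x $ 3)) + x $ 1 * (cos (x $ 2) * h $ 2 * cos (x $ 3) - sin (x $ 2) * sin (x $ 3) * h $ 3)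
     else if i = 2 then h $ 1 * (sin (x $ 2) * sin (x $ 3)) + x $ 1 * (cos (x $ 2) * h $ 2 * sin (x $ 3) + sin (x $ 2) * cos (x $ 3) * h $ 3)
     else h $ 1 * cos (x $ 2) - x $ 1 * sin (x $ 2) * h $ 2)"

lemma spherical_nth [simp]:
  "spherical x $ 1 = x $ 1 * (sin (x $ 2) * cos (x $ 3))"
  "spherical x $ 2 = x $ 1 * (sin (x $ 2) * sin (x $ 3))"
  "spherical x $ 3 = x $ 1 * cos (x $ 2)"
  by (simp_all add: spherical_def sph_def)

lemma spherical_has_derivative: "(spherical has_derivative spherical_deriv x) (at x within S)"
proof -
  have nth: "((\<lambda>x. x $ i) has_derivative (\<lambda>h. h $ i)) (at x within S)" for i :: 3 and x :: "real^3"
    by (rule bounded_linear.has_derivative[OF bounded_linear_vec_nth has_derivative_ident])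
  have "((\<lambda>x. spherical x $ i) has_derivative (\<lambda>h. spherical_deriv x h $ i)) (at x within S)" for i
    using exhaust_3[of i]
    by (auto simp: spherical_deriv_def fun_eq_iff algebra_simps intro!: derivative_eq_intros nth)
  then show ?thesis
    by (subst has_derivative_componentwise_within) (auto simp: Basis_vec_def inner_axis)
qed

lemma det_spherical_deriv: "det (matrix (spherical_deriv x)) = (x $ 1)\<^sup>2 * sin (x $ 2)"
proof -
  \<comment> \<open>The sums of squares are left standing so that the claim is a polynomial identity
    in sines and cosines.\<close>
  have "det (matrix (spherical_deriv x)) = (x $ 1)\<^sup>2 * sin (x $ 2) *
      ((sin (x $ 2))\<^sup>2 + (cos (x $ 2))\<^sup>2) * ((sin (x $ 3))\<^sup>2 + (cos (x $ 3))\<^sup>2)"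
    by (simp add: det_3 matrix_def spherical_deriv_def axis_def del: sin_cos_squared_add sin_cos_squared_add2)
       (simp add: algebra_simps power2_eq_square del: sin_cos_squared_add sin_cos_squared_add2 sin_cos_squared_add3)
  then show ?thesis by simp
qed

lemma norm_sph [simp]: "norm (sph p) = 1"
proof -
  have "(norm (sph p))\<^sup>2 = (sin (fst p) * cos (snd p))\<^sup>2 + (sin (fst p) * sin (snd p))\<^sup>2 + (cos (fst p))\<^sup>2"
    by (simp only: norm_cart_power2 UNIV_3) (simp add: sph_def)
  also have "\<dots> = 1"
    using sin_cos_squared_add[of "fst p"] sin_cos_squared_add[of "snd p"] by algebra
  finally have "(norm (sph p))\<^sup>2 = 1" .
  then show ?thesis using power2_eq_iff_nonneg[of "norm (sph p)" 1] by simp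
qed

lemma norm_spherical: "x $ 1 \<ge> 0 \<Longrightarrow> norm (spherical x) = x $ 1"
  by (simp add: spherical_def)

text \<open>An open set of radius, polar angle and azimuth; leaving out the boundary angles makes
  the coordinates injective.\<close>

definition spherical_dom :: "(real^3) set" where
  "spherical_dom = {x. 0 < x $ 1 \<and> 0 < x $ 2 \<and> x $ 2 < pi \<and> 0 < x $ 3 \<and> x $ 3 < 2 * pi}"

lemma inj_on_spherical: "inj_on spherical spherical_dom"
proof (rule inj_onI)
  fix x y assume x: "x \<in> spherical_dom" and y: "y \<in> spherical_dom" and eq: "spherical x = spherical y"
  have 1: "x $ 1 = y $ 1"
    using norm_spherical[of x] norm_spherical[of y] x y eq by (auto simp: spherical_dom_def)
  have nz: "x $ 1 \<noteq> 0" "y $ 1 \<noteq> 0" using x y by (auto simp: spherical_dom_def)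
  have "cos (x $ 2) = cos (y $ 2)"
    using arg_cong[OF eq, of "\<lambda>v. v $ 3"] nz 1 by simp
  then have 2: "x $ 2 = y $ 2"
    using x y by (auto simp: spherical_dom_def intro: cos_inj_pi)
  have "sin (x $ 2) \<noteq> 0"
    using x sin_gt_zero[of "x $ 2"] by (auto simp: spherical_dom_def)
  then have "sin (x $ 3) = sin (y $ 3) \<and> cos (x $ 3) = cos (y $ 3)"
    using arg_cong[OF eq, of "\<lambda>v. v $ 1"] arg_cong[OF eq, of "\<lambda>v. v $ 2"] nz 1 2 by simp
  then obtain n :: int where n: "x $ 3 = y $ 3 + 2 * pi * n"
    unfolding sin_cos_eq_iff by blast
  \<comment> \<open>Two azimuths in an open interval of length 2 pi cannot differ by a nonzero
    multiple of 2 pi.\<close>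
  have "\<bar>2 * pi * n\<bar> < 2 * pi * 1"
    using x y n unfolding spherical_dom_def mem_Collect_eq abs_less_iff by linarith
  then have "\<bar>real_of_int n\<bar> < 1"
    by (simp add: abs_mult)
  then have "n = 0" by linarith
  then have 3: "x $ 3 = y $ 3" using n by simp
  show "x = y" using 1 2 3 by (simp add: vec_eq_iff forall_3)
qed

text \<open>The excluded plane has measure zero and contains both the polar axis and the half-plane
  of azimuth 0, which the open domain misses.\<close>

lemma spherical_surj:
  assumes v: "v $ 2 \<noteq> 0"
  shows "\<exists>x\<in>spherical_dom. spherical x = v"
proof -
  define \<rho> where "\<rho> = norm v"
  have N: "\<rho>\<^sup>2 = (v $ 1)\<^sup>2 + (v $ 2)\<^sup>2 + (v $ 3)\<^sup>2"
    unfolding \<rho>_def by (simp only: norm_cart_power2 UNIV_3) (simp add: algebra_simps)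
  have pos: "(v $ 2)\<^sup>2 > 0" using v by simp
  have \<rho>: "\<rho> > 0" using v by (auto simp: \<rho>_def)
  \<comment> \<open>Strictness places the polar angle in the open interval (0, pi).\<close>
  have "(v $ 3)\<^sup>2 < \<rho>\<^sup>2" using N pos by (smt (verit) zero_le_power2)
  then have "\<bar>v $ 3\<bar> < \<rho>" using \<rho> by (metis abs_of_pos power2_abs power_less_imp_less_base less_imp_le)
  then have z: "-1 < v $ 3 / \<rho>" "v $ 3 / \<rho> < 1" using \<rho> by (auto simp: field_simps)
  define \<theta> where "\<theta> = arccos (v $ 3 / \<rho>)"
  have \<theta>: "0 < \<theta>" "\<theta> < pi" "cos \<theta> = v $ 3 / \<rho>"
    using arccos_lt_bounded[OF z] z by (auto simp: \<theta>_def)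
  have sp: "sin \<theta> > 0" using \<theta> by (intro sin_gt_zero)
  have "(sin \<theta>)\<^sup>2 = 1 - (v $ 3 / \<rho>)\<^sup>2" using \<theta>(3) by (simp add: sin_squared_eq)
  then have "(\<rho> * sin \<theta>)\<^sup>2 = \<rho>\<^sup>2 - (v $ 3)\<^sup>2"
    using \<rho> by (simp add: power_mult_distrib power_divide right_diff_distrib)
  then have "(\<rho> * sin \<theta>)\<^sup>2 = (v $ 1)\<^sup>2 + (v $ 2)\<^sup>2" using N by simp
  then have "(v $ 1 / (\<rho> * sin \<theta>))\<^sup>2 + (v $ 2 / (\<rho> * sin \<theta>))\<^sup>2 = 1"
    using \<rho> sp v by (simp add: power_divide add_divide_distrib[symmetric])
  then obtain \<phi> where \<phi>: "0 \<le> \<phi>" "\<phi> < 2 * pi" "v $ 1 / (\<rho> * sin \<theta>) = cos \<phi>" "v $ 2 / (\<rho> * sin \<theta>) = sin \<phi>"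
    using sincos_total_2pi by blast
  have "\<phi> \<noteq> 0" using \<phi>(4) v \<rho> sp by auto
  define x :: "real^3" where "x = vector [\<rho>, \<theta>, \<phi>]"
  have x: "x $ 1 = \<rho>" "x $ 2 = \<theta>" "x $ 3 = \<phi>" by (simp_all add: x_def)
  have "x \<in> spherical_dom" using \<rho> \<theta> \<phi> \<open>\<phi> \<noteq> 0\<close> by (simp add: spherical_dom_def x)
  moreover have "spherical x = v"
    using \<phi>(3,4) \<theta>(3) \<rho> sp by (simp add: vec_eq_iff forall_3 x field_simps)
  ultimately show ?thesis by blast
qed

text \<open>The Jacobian, cut off by the closed angle range \<open>sph_dom\<close> used for
  integration over the sphere; this range differs from that of \<open>spherical_dom\<close> only on
  a null set.\<close>

definition spherical_weight :: "real^3 \<Rightarrow> real" where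
  "spherical_weight x = indicator ({0<..} \<times> sph_dom) (x $ 1, (x $ 2, x $ 3)) * ((x $ 1)\<^sup>2 * sin (x $ 2))"

lemma spherical_weight_nonneg: "spherical_weight x \<ge> 0"
  by (auto simp: spherical_weight_def sph_dom_def indicator_def intro!: mult_nonneg_nonneg sin_ge_zero)

lemma borel_measurable_cart_nth [measurable]: "(\<lambda>x::real^'n::finite. x $ i) \<in> borel_measurable borel"
  by (simp add: borel_measurable_continuous_onI continuous_on_component)

lemma continuous_on_spherical: "continuous_on UNIV spherical"
  using spherical_has_derivative by (rule has_derivative_continuous_on)

lemma measurable_spherical [measurable]: "spherical \<in> borel_measurable borel"
  by (rule borel_measurable_continuous_onI[OF continuous_on_spherical])

lemma measurable_spherical_weight [measurable]: "spherical_weight \<in> borel_measurable borel"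
proof -
  have [measurable]: "(sin :: real \<Rightarrow> real) \<in> borel_measurable borel"
    by (intro borel_measurable_continuous_onI continuous_intros)
  have eq: "spherical_weight = (\<lambda>x. if 0 < x $ 1 \<and> 0 \<le> x $ 2 \<and> x $ 2 \<le> pi \<and> 0 \<le> x $ 3 \<and> x $ 3 \<le> 2 * pi
      then (x $ 1)\<^sup>2 * sin (x $ 2) else 0)"
    by (auto simp: spherical_weight_def sph_dom_def indicator_def fun_eq_iff)
  show ?thesis by (subst eq) measurable
qed

lemma AE_lborel_cart_neq: "AE x in lborel. (x::real^'n::finite) $ k \<noteq> a"
proof -
  have "{x::real^'n. x $ k = a} \<in> null_sets lebesgue"
    using negligible_standard_hyperplane[of "axis k 1 :: real^'n" a]
    by (simp add: cart_eq_inner_axis negligible_iff_null_sets[symmetric] axis_in_Basis_iff)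
  moreover have "{x::real^'n. x $ k = a} \<in> sets lborel" by simp
  ultimately have "{x::real^'n. x $ k = a} \<in> null_sets lborel"
    by (simp add: null_sets_completion_iff)
  then show ?thesis by (rule AE_I') auto
qed

text \<open>It suffices to compare the measures of boxes, where the change of variables formula for
  injective differentiable maps applies.\<close>

lemma lborel_spherical: "lborel = distr (density lborel (\<lambda>x. ennreal (spherical_weight x))) borel spherical"
proof (rule lborel_eqI)
  fix l u :: "real^3" assume le: "\<And>b. b \<in> Basis \<Longrightarrow> l \<bullet> b \<le> u \<bullet> b"
  define S where "S = spherical_dom \<inter> spherical -` box l u"
  have "open spherical_dom"
    unfolding spherical_dom_def by (intro open_Collect_conj open_Collect_less continuous_intros)
  then have S_open: "open S"
    unfolding S_def using continuous_on_spherical by (intro open_Int open_vimage) auto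
  then have S: "S \<in> sets lebesgue" by (auto intro: borel_open)
  have inj: "inj_on spherical S" using inj_on_spherical by (rule inj_on_subset) (auto simp: S_def)
  have "spherical ` S \<subseteq> box l u" by (auto simp: S_def)
  \<comment> \<open>The image of \<open>S\<close> fills the box up to a null plane, so the two have
    the same measure.\<close>
  moreover have "box l u - spherical ` S \<subseteq> {v. v $ 2 = 0}"
    using spherical_surj by (fastforce simp: S_def)
  ultimately have "(box l u - spherical ` S) \<union> (spherical ` S - box l u) \<subseteq> {v. v $ 2 = 0}"
    by blast
  then have neg: "negligible ((box l u - spherical ` S) \<union> (spherical ` S - box l u))"
    using negligible_standard_hyperplane_cart negligible_subset by blast
  have bm: "box l u \<in> lmeasurable" by simp
  have "spherical ` S \<in> lmeasurable \<and> measure lebesgue (spherical ` S) = measure lebesgue (box l u)"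
    using lmeasurable_negligible_symdiff[OF bm neg] measure_negligible_symdiff[OF bm neg] by simp
  then have "((\<lambda>x. \<bar>det (matrix (spherical_deriv x))\<bar>) has_integral (measure lebesgue (box l u))) S"
    by (subst (asm) has_measure_differentiable_image[OF S spherical_has_derivative inj])
  then have "((\<lambda>x. \<bar>(x $ 1)\<^sup>2 * sin (x $ 2)\<bar>) has_integral (measure lebesgue (box l u))) S"
    by (simp only: det_spherical_deriv)
  from nn_integral_has_integral_lebesgue[OF _ this]
  have I: "(\<integral>\<^sup>+x. ennreal (indicator S x * \<bar>(x $ 1)\<^sup>2 * sin (x $ 2)\<bar>) \<partial>lborel) = ennreal (measure lebesgue (box l u))"
    by (simp add: nn_integral_completion)
  have mv: "spherical -` box l u \<in> sets borel"
    using measurable_sets[OF measurable_spherical, of "box l u"] by simp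
  have "emeasure (distr (density lborel (\<lambda>x. ennreal (spherical_weight x))) borel spherical) (box l u)
     = (\<integral>\<^sup>+x. ennreal (spherical_weight x) * indicator (spherical -` box l u) x \<partial>lborel)"
    using mv by (simp add: emeasure_distr emeasure_density)
  also have "\<dots> = (\<integral>\<^sup>+x. ennreal (indicator S x * \<bar>(x $ 1)\<^sup>2 * sin (x $ 2)\<bar>) \<partial>lborel)"
  proof (rule nn_integral_cong_AE)
    show "AE x in lborel. ennreal (spherical_weight x) * indicator (spherical -` box l u) x
       = ennreal (indicator S x * \<bar>(x $ 1)\<^sup>2 * sin (x $ 2)\<bar>)"
      \<comment> \<open>Almost everywhere no angle lies on the boundary, and there the closed and
        the open domain agree.\<close>
      using AE_lborel_cart_neq[of 2 0] AE_lborel_cart_neq[of 2 pi] AE_lborel_cart_neq[of 3 0] AE_lborel_cart_neq[of 3 "2 * pi"]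
    proof eventually_elim
      case (elim x)
      then have "(x $ 1, (x $ 2, x $ 3)) \<in> {0<..} \<times> sph_dom \<longleftrightarrow> x \<in> spherical_dom"
        by (auto simp: spherical_dom_def sph_dom_def)
      moreover have "x \<in> spherical_dom \<Longrightarrow> 0 \<le> (x $ 1)\<^sup>2 * sin (x $ 2)"
        by (auto simp: spherical_dom_def intro!: mult_nonneg_nonneg sin_ge_zero)
      ultimately show ?case
        by (auto simp: spherical_weight_def S_def indicator_def)
    qed
  qed
  also have "\<dots> = emeasure lborel (box l u)"
    unfolding I by (subst emeasure_eq_ennreal_measure) (use emeasure_bounded_finite[OF bounded_box, of l u] in auto)
  finally show "emeasure (distr (density lborel (\<lambda>x. ennreal (spherical_weight x))) borel spherical) (box l u)
     = ennreal (\<Prod>b\<in>Basis. (u - l) \<bullet> b)"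
    using le by (simp add: emeasure_lborel_box)
qed simp

section \<open>Exchange of the two directions of a collision\<close>

text \<open>In spherical coordinates for g this exchanges the angles of g with those of the
  scattering direction and keeps |g|; it merely permutes five real coordinates.\<close>

definition angle_swap :: "(real^3) \<times> (real \<times> real) \<Rightarrow> (real^3) \<times> (real \<times> real)" where
  "angle_swap z = (vector [fst z $ 1, fst (snd z), snd (snd z)], (fst z $ 2, fst z $ 3))"

lemma measurable_angle_swap: "angle_swap \<in> borel_measurable borel"
proof -
  have "(\<lambda>z::(real^3) \<times> (real \<times> real). vector [fst z $ 1, fst (snd z), snd (snd z)] :: real^3) \<in> borel_measurable borel"
  proof -
    have "(\<lambda>z::(real^3) \<times> (real \<times> real). \<chi> i. if i = 1 then fst z $ 1 else if i = 2 then fst (snd z) else snd (snd z) :: real^3) \<in> borel_measurable borel"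
    proof (rule borel_measurable_vec_lambda)
      fix i :: 3
      show "(\<lambda>z::(real^3) \<times> (real \<times> real). if i = 1 then fst z $ 1 else if i = 2 then fst (snd z) else snd (snd z)) \<in> borel_measurable borel"
        using exhaust_3[of i] by (auto intro!: borel_measurable_continuous_onI continuous_intros)
    qed
    moreover have "vector [a, b, c] = (\<chi> i. if i = 1 then a else if i = 2 then b else c :: real^3)" for a b c :: real
      by (simp add: vec_eq_iff forall_3)
    ultimately show ?thesis by simp
  qed
  moreover have "(\<lambda>z::(real^3) \<times> (real \<times> real). (fst z $ 2, fst z $ 3)) \<in> borel_measurable borel"
    by (intro borel_measurable_continuous_onI continuous_intros)
  ultimately show ?thesis
    unfolding angle_swap_def[abs_def] by (rule borel_measurable_Pair)
qed

lemma box_Pair: "box (a, b) (c, d) = box a c \<times> box b d"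
  by (auto simp: mem_box Basis_prod_def ball_Un)

lemma emeasure_box_Pair:
  fixes a c :: "'a::euclidean_space" and b d :: "'b::euclidean_space"
  shows "emeasure lborel (box (a, b) (c, d)) = emeasure lborel (box a c) * emeasure lborel (box b d)"
proof -
  have "emeasure (lborel \<Otimes>\<^sub>M lborel) (box a c \<times> box b d) = emeasure lborel (box a c) * emeasure lborel (box b d)"
    by (rule lborel.emeasure_pair_measure_Times) auto
  then show ?thesis by (simp only: lborel_prod box_Pair)
qed

text \<open>The preimage of a box is the box with permuted edges, which has the same volume.\<close>

lemma lborel_distr_angle_swap: "distr lborel borel angle_swap = lborel"
proof (rule sym, rule lborel_eqI)
  fix l u :: "(real^3) \<times> (real \<times> real)"
  assume le: "\<And>b. b \<in> Basis \<Longrightarrow> l \<bullet> b \<le> u \<bullet> b"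
  obtain a a1 a2 where l: "l = (a, (a1, a2))" by (metis surj_pair)
  obtain b b1 b2 where u: "u = (b, (b1, b2))" by (metis surj_pair)
  have le1: "a $ i \<le> b $ i" for i
  proof -
    have "(axis i 1, 0) \<in> (Basis :: ((real^3) \<times> (real \<times> real)) set)"
      by (auto simp: Basis_prod_def axis_in_Basis_iff)
    from le[OF this] show ?thesis by (simp add: l u inner_axis)
  qed
  have le2: "a1 \<le> b1" "a2 \<le> b2"
    using le[of "(0, (1, 0))"] le[of "(0, (0, 1))"] by (simp_all add: l u Basis_prod_def)
  let ?a = "vector [a $ 1, a1, a2] :: real^3" and ?b = "vector [b $ 1, b1, b2] :: real^3"
  have le3: "?a $ i \<le> ?b $ i" for i
    using exhaust_3[of i] le1 le2 by auto
  have "angle_swap -` box l u = box (?a, (a $ 2, a $ 3)) (?b, (b $ 2, b $ 3))"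
    by (auto simp: l u box_Pair angle_swap_def mem_box_cart forall_3)
  then have "emeasure (distr lborel borel angle_swap) (box l u) = emeasure lborel (box (?a, (a $ 2, a $ 3)) (?b, (b $ 2, b $ 3)))"
    using measurable_angle_swap by (simp add: emeasure_distr)
  also have "\<dots> = ennreal (\<Prod>i\<in>UNIV. ?b $ i - ?a $ i) * (ennreal (b $ 2 - a $ 2) * ennreal (b $ 3 - a $ 3))"
    unfolding emeasure_box_Pair by (subst emeasure_box_cart) (use le1 le3 in auto)
  also have "\<dots> = ennreal (\<Prod>i\<in>UNIV. b $ i - a $ i) * (ennreal (b1 - a1) * ennreal (b2 - a2))"
  proof -
    have *: "ennreal (x * (y1 * y2)) * (ennreal z1 * ennreal z2) = ennreal (x * (z1 * z2)) * (ennreal y1 * ennreal y2)"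
      if "x \<ge> 0" "y1 \<ge> 0" "y2 \<ge> 0" "z1 \<ge> 0" "z2 \<ge> 0" for x y1 y2 z1 z2
      using that by (simp only: ennreal_mult mult_nonneg_nonneg) (simp only: mult_ac)
    have P: "(\<Prod>i\<in>UNIV. f i) = f 1 * (f 2 * f 3)" for f :: "3 \<Rightarrow> real"
      by (simp only: UNIV_3) simp
    show ?thesis
      unfolding P vector_3 by (rule *) (simp_all add: le1 le2)
  qed
  also have "\<dots> = emeasure lborel (box l u)"
    unfolding l u emeasure_box_Pair by (subst emeasure_box_cart) (use le1 le2 in auto)
  also have "\<dots> = ennreal (\<Prod>b\<in>Basis. (u - l) \<bullet> b)"
    by (rule emeasure_lborel_box[OF le])
  finally show "emeasure (distr lborel borel angle_swap) (box l u) = ennreal (\<Prod>b\<in>Basis. (u - l) \<bullet> b)" .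
qed simp

text \<open>Spherical coordinates are introduced in the first component only, slice by slice for
  fixed second component.\<close>

lemma lborel_spherical_prod:
  "lborel = distr (density lborel (\<lambda>z. ennreal (spherical_weight (fst z)))) borel
     (\<lambda>z::(real^3) \<times> (real \<times> real). (spherical (fst z), snd z))"
proof (rule measure_eqI)
  have W: "(\<lambda>z::(real^3) \<times> (real \<times> real). ennreal (spherical_weight (fst z))) \<in> borel_measurable borel"
    unfolding borel_prod[symmetric] by simp
  have T: "(\<lambda>z::(real^3) \<times> (real \<times> real). (spherical (fst z), snd z)) \<in> borel_measurable borel"
    unfolding borel_prod[symmetric] by simp
  fix A :: "((real^3) \<times> (real \<times> real)) set"
  assume "A \<in> sets lborel"
  then have A: "A \<in> sets borel" by simp
  have A': "A \<in> sets (lborel \<Otimes>\<^sub>M lborel)" using A by (simp only: lborel_prod sets_lborel)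
  let ?T = "(\<lambda>z. (spherical (fst z), snd z)) -` A"
  have TA: "?T \<in> sets borel" using measurable_sets[OF T A] by simp
  have Ay: "(\<lambda>x. (x, y)) -` A \<in> sets borel" for y
    using sets_Pair2[OF A', of y] by simp
  have Sy: "spherical -` (\<lambda>x. (x, y)) -` A \<in> sets borel" for y
    using measurable_sets[OF measurable_spherical Ay[of y]] by simp
  have "emeasure lborel A = (\<integral>\<^sup>+y. emeasure lborel ((\<lambda>x. (x, y)) -` A) \<partial>lborel)"
    using lborel_pair.emeasure_pair_measure_alt2[OF A'] by (simp only: lborel_prod)
  also have "\<dots> = (\<integral>\<^sup>+y. \<integral>\<^sup>+x. ennreal (spherical_weight x) * indicator ?T (x, y) \<partial>lborel \<partial>lborel)"
  proof (rule nn_integral_cong)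
    fix y :: "real \<times> real"
    have "emeasure lborel ((\<lambda>x. (x, y)) -` A)
        = (\<integral>\<^sup>+x. ennreal (spherical_weight x) * indicator (spherical -` (\<lambda>x. (x, y)) -` A) x \<partial>lborel)"
      by (subst lborel_spherical) (simp add: emeasure_distr emeasure_density Ay Sy)
    then show "emeasure lborel ((\<lambda>x. (x, y)) -` A) = (\<integral>\<^sup>+x. ennreal (spherical_weight x) * indicator ?T (x, y) \<partial>lborel)"
      by (simp add: indicator_def)
  qed
  also have "\<dots> = (\<integral>\<^sup>+z. ennreal (spherical_weight (fst z)) * indicator ?T z \<partial>(lborel \<Otimes>\<^sub>M lborel))"
  proof (subst lborel_pair.nn_integral_snd[symmetric])
    show "(\<lambda>z. ennreal (spherical_weight (fst z)) * indicator ?T z) \<in> borel_measurable (lborel \<Otimes>\<^sub>M lborel)"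
      unfolding lborel_prod using W TA by simp
  qed (simp add: case_prod_unfold)
  also have "\<dots> = emeasure (distr (density lborel (\<lambda>z. ennreal (spherical_weight (fst z)))) borel
     (\<lambda>z::(real^3) \<times> (real \<times> real). (spherical (fst z), snd z))) A"
    unfolding lborel_prod using W T TA A by (simp add: emeasure_distr emeasure_density)
  finally show "emeasure lborel A = emeasure (distr (density lborel (\<lambda>z. ennreal (spherical_weight (fst z)))) borel
     (\<lambda>z::(real^3) \<times> (real \<times> real). (spherical (fst z), snd z))) A" .
qed simp

lemma integral_spherical_prod:
  fixes f :: "(real^3) \<times> (real \<times> real) \<Rightarrow> real"
  assumes f: "f \<in> borel_measurable borel"
  shows "(LINT z|lborel. f z) = (LINT z|lborel. spherical_weight (fst z) * f (spherical (fst z), snd z))"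
proof -
  have W: "(\<lambda>z::(real^3) \<times> (real \<times> real). spherical_weight (fst z)) \<in> borel_measurable borel"
    unfolding borel_prod[symmetric] by simp
  have T: "(\<lambda>z::(real^3) \<times> (real \<times> real). (spherical (fst z), snd z)) \<in> borel_measurable borel"
    unfolding borel_prod[symmetric] by simp
  have fT: "(\<lambda>z. f (spherical (fst z), snd z)) \<in> borel_measurable borel"
    using measurable_compose[OF T f] by simp
  show ?thesis
    by (subst lborel_spherical_prod, subst integral_distr)
       (use T f fT W in \<open>auto simp: integral_density spherical_weight_nonneg\<close>)
qed

text \<open>In the difference of the two integrands the products of both polynomials at g cancel.
  What remains, H_j(g') H_k(g) - H_k(g') H_j(g) times a symmetric weight, changes sign when the
  directions of g and g' are exchanged, so its integral is its own negative.\<close>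

lemma gamma_coef_sym:
  assumes I: "\<And>j k. set_integrable lborel (UNIV \<times> sph_dom) (gamma_integrand Bk r z j k)"
  shows "gamma_coef Bk r z j k = gamma_coef Bk r z k j"
proof -
  define D where "D x = indicator (UNIV \<times> sph_dom) x * (gamma_integrand Bk r z j k x - gamma_integrand Bk r z k j x)"
    for x :: "(real^3) \<times> (real \<times> real)"
  define E where "E x = spherical_weight (fst x) * D (spherical (fst x), snd x)" for x
  have "set_integrable lborel (UNIV \<times> sph_dom) (\<lambda>x. gamma_integrand Bk r z j k x - gamma_integrand Bk r z k j x)"
    by (intro set_integral_diff I)
  then have D: "integrable lborel D" by (simp add: set_integrable_def D_def[abs_def])
  have swap: "E (angle_swap x) = - E x" for x
  proof -
    obtain v a b where x: "x = (v, (a, b))" by (metis surj_pair)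
    let ?H = "\<lambda>i y. hermite 0 z i (sqrt (r / (1 + r)) *\<^sub>R y)"
    show ?thesis
    \<comment> \<open>A positive radius lets the kernel's angle reduce to that between two unit
      vectors, which is symmetric. The condition is itself invariant under the swap, so otherwise
      both sides vanish.\<close>
    proof (cases "v $ 1 > 0 \<and> (v $ 2, v $ 3) \<in> sph_dom \<and> (a, b) \<in> sph_dom")
      case True
      have M: "maxwellian 0 z ((v $ 1 * sqrt (r / (1 + r))) *\<^sub>R sph p) = maxwellian 0 z ((v $ 1 * sqrt (r / (1 + r))) *\<^sub>R sph q)" for p q
        by (simp add: maxwellian_def)
      show ?thesis
        using True
        by (simp add: E_def D_def x angle_swap_def spherical_weight_def gamma_integrand_def Let_def
              spherical_def collB_def inner_commute)
           (simp add: algebra_simps M[of "(a, b)" "(v $ 2, v $ 3)"])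
    next
      case False
      then show ?thesis
        by (auto simp: E_def D_def x angle_swap_def spherical_weight_def indicator_def)
    qed
  qed
  have diff: "gamma_coef Bk r z j k - gamma_coef Bk r z k j = (LINT x|lborel. D x)"
    unfolding gamma_coef_def D_def
    using I by (subst set_integral_diff(2)[symmetric]) (auto simp: set_lebesgue_integral_def)
  have DE: "(LINT x|lborel. D x) = (LINT x|lborel. E x)"
    using D unfolding E_def by (intro integral_spherical_prod) auto
  have "(LINT x|lborel. E x) = (LINT x|distr lborel borel angle_swap. E x)"
    by (simp only: lborel_distr_angle_swap)
  also have "\<dots> = (LINT x|lborel. E (angle_swap x))"
  proof (rule integral_distr)
    have T: "(\<lambda>z::(real^3) \<times> (real \<times> real). (spherical (fst z), snd z)) \<in> borel_measurable borel"
      and W: "(\<lambda>z::(real^3) \<times> (real \<times> real). spherical_weight (fst z)) \<in> borel_measurable borel"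
      unfolding borel_prod[symmetric] by simp_all
    have "D \<in> borel_measurable borel" using D by (auto dest: borel_measurable_integrable)
    from borel_measurable_times[OF W measurable_compose[OF T this]]
    show "E \<in> borel_measurable borel" by (simp add: E_def[abs_def])
  qed (use measurable_angle_swap in simp)
  also have "\<dots> = - (LINT x|lborel. E x)"
    by (simp add: swap)
  finally show ?thesis using diff DE by simp
qed

section \<open>Centre-of-mass variables\<close>

lemma mle_set_eq: "{k. mle k n} = vec_lambda ` (PiE UNIV (\<lambda>i. {..n $ i}))"
proof (intro equalityI subsetI)
  fix k assume "k \<in> {k. mle k n}"
  then have "vec_nth k \<in> PiE UNIV (\<lambda>i. {..n $ i})" by (auto simp: mle_def)
  then have "vec_lambda (vec_nth k) \<in> vec_lambda ` (PiE UNIV (\<lambda>i. {..n $ i}))" by (rule imageI)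
  then show "k \<in> vec_lambda ` (PiE UNIV (\<lambda>i. {..n $ i}))" by simp
qed (auto simp: mle_def)

lemma finite_mle: "finite {k. mle k n}"
  unfolding mle_set_eq by (intro finite_imageI finite_PiE) auto

lemma prod_sum_mle:
  fixes f :: "3 \<Rightarrow> nat \<Rightarrow> real"
  shows "(\<Prod>i\<in>UNIV. \<Sum>k\<le>n $ i. f i k) = (\<Sum>k\<in>{k. mle k n}. \<Prod>i\<in>UNIV. f i (k $ i))"
proof -
  have "(\<Prod>i\<in>UNIV. \<Sum>k\<le>n $ i. f i k) = (\<Sum>g\<in>PiE UNIV (\<lambda>i. {..n $ i}). \<Prod>i\<in>UNIV. f i (g i))"
    by (rule prod_sum_PiE) auto
  also have "\<dots> = (\<Sum>k\<in>{k. mle k n}. \<Prod>i\<in>UNIV. f i (k $ i))"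
    by (rule sum.reindex_bij_witness[of _ vec_nth vec_lambda]) (auto simp: mle_def PiE_def Pi_iff)
  finally show ?thesis .
qed

lemma prod_UNIV_3: "(\<Prod>i\<in>UNIV. f i) = f 1 * f 2 * f (3::3)"
  by (simp only: UNIV_3) (simp add: mult.assoc)

text \<open>In each coordinate the two scaled arguments are a W + b G and b W - a G, so the
  one-variable rotation applies; the product of the three sums becomes a sum over multi-indices. The
  vector y is left arbitrary to cover the relative velocity before and after a collision.\<close>

lemma hermite_pair_com:
  fixes h y :: "real^3"
  assumes r: "r > 0" and z: "z > 0"
  shows "hermite 0 z la (h + (r / (1 + r)) *\<^sub>R y) * hermite 0 (z / r) ka (h - (1 / (1 + r)) *\<^sub>R y) =
    (\<Sum>l\<in>{l. mle l (la + ka)}.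
       (\<Prod>i\<in>UNIV. ccoef (la $ i) (ka $ i) (l $ i) (la $ i + ka $ i - l $ i) r) *
       hermite 0 z l (sqrt (1 + r) *\<^sub>R h) *
       hermite 0 z (\<chi> i. la $ i + ka $ i - l $ i) (sqrt (r / (1 + r)) *\<^sub>R y))"
proof -
  define W where "W i = sqrt (1 + r) * h $ i / sqrt z" for i
  define G where "G i = sqrt (r / (1 + r)) * y $ i / sqrt z" for i
  let ?a = "1 / sqrt (1 + r)" and ?b = "sqrt (r / (1 + r))"
  have bb: "?b * ?b = r / (1 + r)" using r by simp
  have b1: "?b * sqrt (1 + r) = sqrt r" using r by (simp add: real_sqrt_divide)
  have ab: "?a * ?b = sqrt r / (1 + r)" using r by (simp add: real_sqrt_divide)
  have 1: "(h + (r / (1 + r)) *\<^sub>R y) $ i / sqrt z = ?a * W i + ?b * G i" for i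
  proof -
    have "?a * W i = h $ i / sqrt z" using r by (simp add: W_def)
    moreover have "?b * G i = (?b * ?b) * y $ i / sqrt z"
      unfolding G_def by (simp only: times_divide_eq_right mult.assoc)
    ultimately show ?thesis unfolding bb by (simp add: add_divide_distrib)
  qed
  have 2: "(h - (1 / (1 + r)) *\<^sub>R y) $ i / sqrt (z / r) = ?b * W i - ?a * G i" for i
  proof -
    have "?b * W i - ?a * G i = (?b * sqrt (1 + r)) * h $ i / sqrt z - (?a * ?b) * y $ i / sqrt z"
      by (simp only: W_def G_def) (simp add: mult_ac)
    also have "\<dots> = sqrt r * (h $ i - y $ i / (1 + r)) / sqrt z"
      unfolding b1 ab by (simp add: right_diff_distrib diff_divide_distrib)
    finally show ?thesis using r by (simp add: real_sqrt_divide mult.commute)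
  qed
  have "hermite 0 z la (h + (r / (1 + r)) *\<^sub>R y) * hermite 0 (z / r) ka (h - (1 / (1 + r)) *\<^sub>R y)
      = (\<Prod>i\<in>UNIV. poly (hermite_poly (la $ i)) (?a * W i + ?b * G i) * poly (hermite_poly (ka $ i)) (?b * W i - ?a * G i))"
    using r z by (simp only: hermite_eq_prod divide_pos_pos 1 2 prod.distrib)
  also have "\<dots> = (\<Prod>i\<in>UNIV. \<Sum>l\<le>(la + ka) $ i. ccoef (la $ i) (ka $ i) l (la $ i + ka $ i - l) r *
      poly (hermite_poly l) (W i) * poly (hermite_poly (la $ i + ka $ i - l)) (G i))"
    unfolding hermite_poly_rotation_ccoef[OF r] by simp
  also have "\<dots> = (\<Sum>l\<in>{l. mle l (la + ka)}. \<Prod>i\<in>UNIV.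
      ccoef (la $ i) (ka $ i) (l $ i) (la $ i + ka $ i - l $ i) r *
      poly (hermite_poly (l $ i)) (W i) * poly (hermite_poly (la $ i + ka $ i - l $ i)) (G i))"
    by (rule prod_sum_mle)
  finally show ?thesis
    using z by (simp add: hermite_eq_prod prod.distrib W_def G_def)
qed

text \<open>The test polynomial depends on one velocity only, so the addition formula suffices and
  its coefficients are plain binomials.\<close>

lemma hermite_com:
  fixes h y :: "real^3"
  assumes r: "r > 0" and z: "z > 0"
  shows "hermite 0 z al (h + (r / (1 + r)) *\<^sub>R y) =
    (\<Sum>m\<in>{m. mle m al}.
       (\<Prod>i\<in>UNIV. real (al $ i choose m $ i) * (1 / sqrt (1 + r)) ^ (m $ i) * sqrt (r / (1 + r)) ^ (al $ i - m $ i)) *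
       hermite 0 z m (sqrt (1 + r) *\<^sub>R h) *
       hermite 0 z (\<chi> i. al $ i - m $ i) (sqrt (r / (1 + r)) *\<^sub>R y))"
proof -
  define W where "W i = sqrt (1 + r) * h $ i / sqrt z" for i
  define G where "G i = sqrt (r / (1 + r)) * y $ i / sqrt z" for i
  let ?a = "1 / sqrt (1 + r)" and ?b = "sqrt (r / (1 + r))"
  have bb: "?b * ?b = r / (1 + r)" using r by simp
  have ab: "?a\<^sup>2 + ?b\<^sup>2 = 1"
    using r by (simp add: power_divide field_simps)
  have 1: "(h + (r / (1 + r)) *\<^sub>R y) $ i / sqrt z = ?a * W i + ?b * G i" for i
  proof -
    have "?a * W i = h $ i / sqrt z" using r by (simp add: W_def)
    moreover have "?b * G i = (?b * ?b) * y $ i / sqrt z"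
      unfolding G_def by (simp only: times_divide_eq_right mult.assoc)
    ultimately show ?thesis unfolding bb by (simp add: add_divide_distrib)
  qed
  have "hermite 0 z al (h + (r / (1 + r)) *\<^sub>R y) = (\<Prod>i\<in>UNIV. poly (hermite_poly (al $ i)) (?a * W i + ?b * G i))"
    using z by (simp only: hermite_eq_prod 1)
  also have "\<dots> = (\<Prod>i\<in>UNIV. \<Sum>m\<le>al $ i. real (al $ i choose m) * ?a ^ m * ?b ^ (al $ i - m) *
      (poly (hermite_poly m) (W i) * poly (hermite_poly (al $ i - m)) (G i)))"
    unfolding hermite_poly_add[OF ab] binom_sum_eq ..
  also have "\<dots> = (\<Sum>m\<in>{m. mle m al}. \<Prod>i\<in>UNIV.
      real (al $ i choose m $ i) * ?a ^ (m $ i) * ?b ^ (al $ i - m $ i) *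
      (poly (hermite_poly (m $ i)) (W i) * poly (hermite_poly (al $ i - m $ i)) (G i)))"
    by (rule prod_sum_mle)
  also have "\<dots> = (\<Sum>m\<in>{m. mle m al}.
       (\<Prod>i\<in>UNIV. real (al $ i choose m $ i) * ?a ^ (m $ i) * ?b ^ (al $ i - m $ i)) *
       hermite 0 z m (sqrt (1 + r) *\<^sub>R h) *
       hermite 0 z (\<chi> i. al $ i - m $ i) (?b *\<^sub>R y))"
    unfolding prod.distrib[of _ "\<lambda>i. poly (hermite_poly _) (W i) * poly (hermite_poly _) (G i)"] hermite_eq_prod[OF z]
    by (simp only: prod.distrib W_def G_def vector_scaleR_component vec_lambda_beta real_scaleR_def mult.assoc)
  finally show ?thesis .
qed

text \<open>Energy splits into a centre-of-mass part and a relative part, the cross terms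
  cancelling. The factor r^(3/2) comes from the normalisation at temperature z / r.\<close>

lemma maxwellian_pair_com:
  fixes h y :: "real^3"
  assumes r: "r > 0" and z: "z > 0"
  shows "maxwellian 0 z (h + (r / (1 + r)) *\<^sub>R y) * maxwellian 0 (z / r) (h - (1 / (1 + r)) *\<^sub>R y) =
    r powr (3/2) * maxwellian 0 z (sqrt (1 + r) *\<^sub>R h) * maxwellian 0 z (sqrt (r / (1 + r)) *\<^sub>R y)"
proof -
  have n1: "(norm (h + (r / (1 + r)) *\<^sub>R y))\<^sup>2 = (norm h)\<^sup>2 + 2 * (r / (1 + r)) * (h \<bullet> y) + (r / (1 + r))\<^sup>2 * (norm y)\<^sup>2"
    by (simp only: power2_norm_eq_inner) (simp add: inner_add_left inner_add_right inner_commute power2_eq_square)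
  have n2: "(norm (h - (1 / (1 + r)) *\<^sub>R y))\<^sup>2 = (norm h)\<^sup>2 - 2 * (1 / (1 + r)) * (h \<bullet> y) + (1 / (1 + r))\<^sup>2 * (norm y)\<^sup>2"
    by (simp only: power2_norm_eq_inner) (simp add: inner_diff_left inner_diff_right inner_commute power2_eq_square)
  have n3: "(norm (sqrt (1 + r) *\<^sub>R h))\<^sup>2 = (1 + r) * (norm h)\<^sup>2"
    and n4: "(norm (sqrt (r / (1 + r)) *\<^sub>R y))\<^sup>2 = r / (1 + r) * (norm y)\<^sup>2"
    using r by (simp_all add: power_mult_distrib)
  \<comment> \<open>With r q = 1 - q the coefficient of |y|^2 collapses: (r q)^2 + r q^2 = r q (r q
    + q) = r q.\<close>
  define q where "q = 1 / (1 + r)"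
  have q: "r / (1 + r) = r * q" "r * q = 1 - q" using r by (auto simp: q_def field_simps)
  have "(r * q)\<^sup>2 + r * q\<^sup>2 = r * q * (r * q + q)" by (simp add: power2_eq_square algebra_simps)
  also have "\<dots> = r * q" using q(2) by simp
  finally have q2: "(r * q)\<^sup>2 + r * q\<^sup>2 = r / (1 + r)" by (simp only: q(1))
  have "(norm (h + (r / (1 + r)) *\<^sub>R y))\<^sup>2 + r * (norm (h - (1 / (1 + r)) *\<^sub>R y))\<^sup>2
     = (1 + r) * (norm h)\<^sup>2 + ((r * q)\<^sup>2 + r * q\<^sup>2) * (norm y)\<^sup>2"
    unfolding n1 n2 unfolding q(1) q_def[symmetric] by (simp add: algebra_simps)
  then have S: "(norm (h + (r / (1 + r)) *\<^sub>R y))\<^sup>2 + r * (norm (h - (1 / (1 + r)) *\<^sub>R y))\<^sup>2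
     = (norm (sqrt (1 + r) *\<^sub>R h))\<^sup>2 + (norm (sqrt (r / (1 + r)) *\<^sub>R y))\<^sup>2"
    unfolding q2 n3 n4 .
  have "- A / (2 * z) + - B / (2 * (z / r)) = - C / (2 * z) + - D / (2 * z)" if "A + r * B = C + D" for A B C D
  proof -
    have "- A / (2 * z) + - B / (2 * (z / r)) = - (A + r * B) / (2 * z)"
      using r z by (simp add: field_simps)
    then show ?thesis unfolding that by (simp only: minus_add_distrib add_divide_distrib)
  qed
  from this[OF S] have E: "- (norm (h + (r / (1 + r)) *\<^sub>R y))\<^sup>2 / (2 * z) + - (norm (h - (1 / (1 + r)) *\<^sub>R y))\<^sup>2 / (2 * (z / r))
     = - (norm (sqrt (1 + r) *\<^sub>R h))\<^sup>2 / (2 * z) + - (norm (sqrt (r / (1 + r)) *\<^sub>R y))\<^sup>2 / (2 * z)"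
    .
  have P: "(2 * pi * (z / r)) powr (- 3 / 2) = r powr (3/2) * (2 * pi * z) powr (- 3 / 2)"
    using r z powr_divide[of "2 * pi * z" r "-3/2"] by (simp add: powr_minus divide_simps)
  show ?thesis
    unfolding maxwellian_def diff_zero P
    using arg_cong[OF E, of exp] unfolding exp_add by simp
qed

text \<open>Substitution x to k x; the divisor s is the normalisation that each coordinate of the
  Maxwellian carries.\<close>

lemma integral_poly_scaled_normal:
  fixes k s :: real
  assumes k: "k > 0"
  shows "integrable lborel (\<lambda>x. poly p (k * x) * (std_normal_density (k * x) / s))"
    and "(LINT x|lborel. poly p (k * x) * (std_normal_density (k * x) / s)) = gauss_mean p / (k * s)"
proof -
  have I: "integrable lborel (\<lambda>x. poly p x * (std_normal_density x / s))"
    using integrable_poly_std_normal[of p] by simp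
  show "integrable lborel (\<lambda>x. poly p (k * x) * (std_normal_density (k * x) / s))"
    using lborel_integrable_real_affine[OF I, of k 0] k by simp
  have "gauss_mean p / s = (LINT x|lborel. poly p x * (std_normal_density x / s))"
    by (simp add: gauss_mean_def)
  also have "\<dots> = k * (LINT x|lborel. poly p (k * x) * (std_normal_density (k * x) / s))"
    using lborel_integral_real_affine[of k "\<lambda>x. poly p x * (std_normal_density x / s)" 0] k by simp
  finally have "gauss_mean p / s / k = (LINT x|lborel. poly p (k * x) * (std_normal_density (k * x) / s))"
    using k by (simp only: nonzero_mult_div_cancel_left less_imp_neq[OF k, symmetric] not_False_eq_True)
  then show "(LINT x|lborel. poly p (k * x) * (std_normal_density (k * x) / s)) = gauss_mean p / (k * s)"
    by (simp add: mult.commute)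
qed

text \<open>Orthogonality factorises over the coordinates. Each contributes 1 / sqrt (1 + r) from
  the rescaling, whence the power -3/2.\<close>

lemma
  fixes l m :: "nat^3"
  assumes r: "r > 0" and z: "z > 0"
  defines "F \<equiv> \<lambda>h. hermite 0 z l (sqrt (1 + r) *\<^sub>R h) * hermite 0 z m (sqrt (1 + r) *\<^sub>R h) * maxwellian 0 z (sqrt (1 + r) *\<^sub>R h)"
  shows integrable_hermite_scaled: "integrable lborel F"
    and integral_hermite_scaled: "(LINT h|lborel. F h) = (1 + r) powr (-3/2) * (if l = m then real (mfact l) else 0)"
proof -
  define k where "k = sqrt (1 + r) / sqrt z"
  have k: "k > 0" using r z by (simp add: k_def)
  let ?f = "\<lambda>i x. poly (hermite_poly (l $ i) * hermite_poly (m $ i)) (k * x) * (std_normal_density (k * x) / sqrt z)"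
  have F: "F = (\<lambda>h. \<Prod>i\<in>UNIV. ?f i (h $ i))"
    unfolding F_def hermite_eq_prod[OF z] maxwellian_0_prod[OF z]
    by (simp add: prod.distrib[symmetric] k_def)
  show "integrable lborel F"
    unfolding F by (intro integrable_prod_cart integral_poly_scaled_normal k)
  have kz: "k * sqrt z = sqrt (1 + r)" using z by (simp add: k_def)
  have e: "(1 + r) powr (-3/2) = (1 / sqrt (1 + r)) * (1 / sqrt (1 + r)) * (1 / sqrt (1 + r))"
  proof -
    have "1 / sqrt (1 + r) = (1 + r) powr (-1/2)"
      using r by (simp add: powr_half_sqrt[symmetric] powr_minus_divide)
    then show ?thesis by (simp only: powr_add[symmetric]) simp
  qed
  have "(LINT h|lborel. F h) = (\<Prod>i\<in>UNIV. LINT x|lborel. ?f i x)"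
    unfolding F by (intro integral_prod_cart integral_poly_scaled_normal k)
  also have "\<dots> = (\<Prod>i\<in>UNIV. (if l $ i = m $ i then fact (l $ i) else 0) / sqrt (1 + r))"
    unfolding integral_poly_scaled_normal(2)[OF k] gauss_mean_hermite_poly_mult kz by (auto intro!: prod.cong)
  also have "\<dots> = (1 + r) powr (-3/2) * (if l = m then real (mfact l) else 0)"
    unfolding prod_UNIV_3 e by (auto simp: vec_eq_iff forall_3 mfact_def)
  finally show "(LINT h|lborel. F h) = (1 + r) powr (-3/2) * (if l = m then real (mfact l) else 0)" .
qed

section \<open>Fubini, the change to centre-of-mass variables and the transformed integrand\<close>

lemma
  fixes f :: "'a::euclidean_space \<Rightarrow> real" and g :: "'b::euclidean_space \<Rightarrow> real"
  assumes f: "integrable lborel f" and g: "integrable lborel g"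
  shows integrable_lborel_times: "integrable lborel (\<lambda>z. f (fst z) * g (snd z))"
    and integral_lborel_times: "(LINT z|lborel. f (fst z) * g (snd z)) = (LINT x|lborel. f x) * (LINT y|lborel. g y)"
proof -
  have [measurable]: "f \<in> borel_measurable borel" "g \<in> borel_measurable borel"
    using f g by (auto dest: borel_measurable_integrable)
  have I: "integrable (lborel \<Otimes>\<^sub>M lborel) (\<lambda>z. f (fst z) * g (snd z))"
    by (rule lborel_pair.Fubini_integrable) (use f g in \<open>auto simp: abs_mult\<close>)
  then show "integrable lborel (\<lambda>z. f (fst z) * g (snd z))"
    by (simp only: lborel_prod)
  have "(LINT z|(lborel \<Otimes>\<^sub>M lborel). f (fst z) * g (snd z)) = (LINT x|lborel. f x) * (LINT y|lborel. g y)"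
    by (subst lborel_pair.integral_fst'[OF I, symmetric]) simp
  then show "(LINT z|lborel. f (fst z) * g (snd z)) = (LINT x|lborel. f x) * (LINT y|lborel. g y)"
    by (simp only: lborel_prod)
qed

text \<open>Maps centre of mass h and relative velocity g back to the two velocities; the last
  component carries the angles along unchanged.\<close>

definition com_map :: "real \<Rightarrow> 'a \<times> ('a \<times> 'b) \<Rightarrow> 'a::euclidean_space \<times> ('a \<times> 'b::euclidean_space)" where
  "com_map r z = (fst z + (r / (1 + r)) *\<^sub>R fst (snd z), (fst z - (1 / (1 + r)) *\<^sub>R fst (snd z), snd (snd z)))"

lemma measurable_com_map: "com_map r \<in> borel_measurable borel"
  unfolding com_map_def[abs_def] by (intro borel_measurable_continuous_onI continuous_intros)

text \<open>The map is a composition of two fibrewise maps: h becomes v = h + r/(1+r) g, then g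
  becomes v - g. The first acts by translations, the second by reflections.\<close>

lemma lborel_distr_com_map:
  assumes r: "r > 0"
  shows "distr lborel borel (com_map r) = lborel"
proof -
  let ?t1 = "\<lambda>(y :: 'a \<times> 'b) x :: 'a. x + (r / (1 + r)) *\<^sub>R fst y"
  let ?t2 = "\<lambda>(x :: 'a) (y :: 'a \<times> 'b). (x - fst y, snd y)"
  let ?S1 = "\<lambda>(x :: 'a, y :: 'a \<times> 'b). (?t1 y x, y)"
  let ?S2 = "\<lambda>(x :: 'a, y :: 'a \<times> 'b). (x, ?t2 x y)"
  have 1: "distr lborel borel ?S1 = lborel"
  proof (rule lborel_distr_fibre_fst)
    show "(\<lambda>(y, x). ?t1 y x) \<in> borel_measurable borel"
      unfolding case_prod_beta' by (intro borel_measurable_continuous_onI continuous_intros)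
    have "?t1 y = (+) ((r / (1 + r)) *\<^sub>R fst y)" for y by (simp add: fun_eq_iff add.commute)
    then show "distr lborel borel (?t1 y) = lborel" for y
      by (simp only: lborel_distr_plus)
  qed
  have t2: "?t2 x = (\<lambda>(u, w). (x - u, w))" for x by (simp add: fun_eq_iff)
  have 2: "distr lborel borel ?S2 = lborel"
  proof (rule lborel_distr_fibre_snd)
    show "(\<lambda>(x, y). ?t2 x y) \<in> borel_measurable borel"
      unfolding case_prod_beta' by (intro borel_measurable_continuous_onI continuous_intros)
    show "distr lborel borel (?t2 x) = lborel" for x
      unfolding t2
    proof (rule lborel_distr_fibre_fst)
      show "(\<lambda>(y :: 'b, u). x - u) \<in> borel_measurable borel"
        unfolding case_prod_beta' by (intro borel_measurable_continuous_onI continuous_intros)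
    qed (rule lborel_distr_minus_left)
  qed
  have "com_map r z = ?S2 (?S1 z)" for z :: "'a \<times> ('a \<times> 'b)"
  proof -
    have "(r / (1 + r)) *\<^sub>R v - v = (- (1 / (1 + r))) *\<^sub>R v" for v :: 'a
    proof -
      have "(r / (1 + r)) *\<^sub>R v - v = (r / (1 + r) - 1) *\<^sub>R v" by (simp only: scaleR_diff_left scaleR_one)
      also have "r / (1 + r) - 1 = - (1 / (1 + r))" using r by (simp add: field_simps)
      finally show ?thesis .
    qed
    from this[of "fst (snd z)"] show ?thesis
      by (simp add: com_map_def case_prod_beta' algebra_simps)
  qed
  then have eq: "(com_map r :: 'a \<times> ('a \<times> 'b) \<Rightarrow> _) = ?S2 \<circ> ?S1" by (simp add: fun_eq_iff)
  have m1: "?S1 \<in> borel_measurable borel" and m2: "?S2 \<in> borel_measurable borel"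
    unfolding case_prod_beta' by (intro borel_measurable_continuous_onI continuous_intros)+
  have "distr lborel borel (?S2 \<circ> ?S1) = distr (distr lborel borel ?S1) borel ?S2"
    using m1 m2 by (intro distr_distr[symmetric]) simp_all
  then show ?thesis unfolding eq 1 2 .
qed

lemma integral_com_map:
  fixes f :: "'a::euclidean_space \<times> ('a \<times> 'b::euclidean_space) \<Rightarrow> real"
  assumes "r > 0" "f \<in> borel_measurable borel"
  shows "(LINT z|lborel. f z) = (LINT z|lborel. f (com_map r z))"
proof -
  have "(LINT z|lborel. f z) = (LINT z|distr lborel borel (com_map r). f z)"
    by (simp only: lborel_distr_com_map[OF assms(1)])
  also have "\<dots> = (LINT z|lborel. f (com_map r z))"
    by (rule integral_distr) (use assms(2) measurable_com_map[of r] in simp_all)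
  finally show ?thesis .
qed

text \<open>Momentum conservation: h is the centre of mass, since the contributions of g to it
  cancel, and the collision only turns g into |g| times the new direction.\<close>

lemma vpost_com_map:
  assumes "mi > 0" "mj > 0"
  defines "r \<equiv> mj / mi"
  shows "vpost mi mj (h + (r / (1 + r)) *\<^sub>R g) (h - (1 / (1 + r)) *\<^sub>R g) \<sigma> = h + (r / (1 + r)) *\<^sub>R (norm g *\<^sub>R \<sigma>)"
    and "vspost mi mj (h + (r / (1 + r)) *\<^sub>R g) (h - (1 / (1 + r)) *\<^sub>R g) \<sigma> = h - (1 / (1 + r)) *\<^sub>R (norm g *\<^sub>R \<sigma>)"
proof -
  have r: "r > 0" using assms by simp
  have mj: "mj / (mi + mj) = r / (1 + r)" and mi: "mi / (mi + mj) = 1 / (1 + r)"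
    using assms by (auto simp: field_simps)
  have "(h + (r / (1 + r)) *\<^sub>R g) - (h - (1 / (1 + r)) *\<^sub>R g) = (r / (1 + r) + 1 / (1 + r)) *\<^sub>R g"
    by (simp add: scaleR_add_left)
  also have "r / (1 + r) + 1 / (1 + r) = 1" using r by (simp add: add_divide_distrib[symmetric])
  finally have d: "(h + (r / (1 + r)) *\<^sub>R g) - (h - (1 / (1 + r)) *\<^sub>R g) = g" by simp
  have "(1 / (mi + mj)) *\<^sub>R (mi *\<^sub>R (h + (r / (1 + r)) *\<^sub>R g) + mj *\<^sub>R (h - (1 / (1 + r)) *\<^sub>R g))
     = (mi / (mi + mj) + mj / (mi + mj)) *\<^sub>R h + (mi / (mi + mj) * (r / (1 + r)) - mj / (mi + mj) * (1 / (1 + r))) *\<^sub>R g"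
    by (simp add: algebra_simps)
  also have "mi / (mi + mj) + mj / (mi + mj) = 1"
    using \<open>mi > 0\<close> \<open>mj > 0\<close> by (simp add: add_divide_distrib[symmetric])
  also have "mi / (mi + mj) * (r / (1 + r)) - mj / (mi + mj) * (1 / (1 + r)) = 0"
    unfolding mi mj by simp
  finally have c: "(1 / (mi + mj)) *\<^sub>R (mi *\<^sub>R (h + (r / (1 + r)) *\<^sub>R g) + mj *\<^sub>R (h - (1 / (1 + r)) *\<^sub>R g)) = h"
    by simp
  show "vpost mi mj (h + (r / (1 + r)) *\<^sub>R g) (h - (1 / (1 + r)) *\<^sub>R g) \<sigma> = h + (r / (1 + r)) *\<^sub>R (norm g *\<^sub>R \<sigma>)"
    and "vspost mi mj (h + (r / (1 + r)) *\<^sub>R g) (h - (1 / (1 + r)) *\<^sub>R g) \<sigma> = h - (1 / (1 + r)) *\<^sub>R (norm g *\<^sub>R \<sigma>)"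
    unfolding vpost_def vspost_def c d mi mj by simp_all
qed

text \<open>Gain and loss term have the same expansion, evaluated at g' and at g, so their
  difference produces the bracket of \<open>gamma_integrand\<close>. That bracket carries the index
  coming from \<open>la\<close> and \<open>ka\<close>, the opposite of the order in the final
  formula.\<close>

lemma A_integrand_com_map:
  fixes h g :: "real^3"
  assumes mi: "mi > 0" and mj: "mj > 0" and T: "T > 0"
  defines "r \<equiv> mj / mi" and "z \<equiv> T / mi"
  shows "A_integrand mi mj T Bk al la ka (com_map r (h, (g, p))) =
    (\<Sum>l\<in>{l. mle l (la + ka)}. \<Sum>m\<in>{m. mle m al}.
       r powr (3/2) * (\<Prod>i\<in>UNIV. ccoef (la $ i) (ka $ i) (l $ i) (la $ i + ka $ i - l $ i) r) *
       (\<Prod>i\<in>UNIV. real (al $ i choose m $ i) * (1 / sqrt (1 + r)) ^ (m $ i) * sqrt (r / (1 + r)) ^ (al $ i - m $ i)) *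
       ((hermite 0 z l (sqrt (1 + r) *\<^sub>R h) * hermite 0 z m (sqrt (1 + r) *\<^sub>R h) * maxwellian 0 z (sqrt (1 + r) *\<^sub>R h)) *
        gamma_integrand Bk r z (\<chi> i. la $ i + ka $ i - l $ i) (\<chi> i. al $ i - m $ i) (g, p)))"
proof -
  have r: "r > 0" and z: "z > 0" using mi mj T by (auto simp: r_def z_def)
  have zj: "T / mj = z / r" using mi mj by (simp add: r_def z_def)
  define u where "u = sqrt (1 + r) *\<^sub>R h"
  define c where "c = sqrt (r / (1 + r))"
  define C where "C l = (\<Prod>i\<in>UNIV. ccoef (la $ i) (ka $ i) (l $ i) (la $ i + ka $ i - l $ i) r)" for l
  define K where "K m = (\<Prod>i\<in>UNIV. real (al $ i choose m $ i) * (1 / sqrt (1 + r)) ^ (m $ i) * sqrt (r / (1 + r)) ^ (al $ i - m $ i))" for m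
  define k' where "k' l = (\<chi> i. la $ i + ka $ i - l $ i)" for l :: "nat^3"
  define j where "j m = (\<chi> i. al $ i - m $ i)" for m :: "nat^3"
  define B where "B = collB Bk g (sph p)"
  define g' where "g' = norm g *\<^sub>R sph p"
  define v where "v = h + (r / (1 + r)) *\<^sub>R g"
  define vs where "vs = h - (1 / (1 + r)) *\<^sub>R g"
  have d: "v - vs = g"
  proof -
    have "v - vs = (r / (1 + r) + 1 / (1 + r)) *\<^sub>R g"
      by (simp add: v_def vs_def scaleR_add_left)
    also have "r / (1 + r) + 1 / (1 + r) = 1" using r by (simp add: field_simps)
    finally show ?thesis by simp
  qed
  have H: "calH z la (h + (r / (1 + r)) *\<^sub>R y) * calH (z / r) ka (h - (1 / (1 + r)) *\<^sub>R y)
     = r powr (3/2) * maxwellian 0 z u * maxwellian 0 z (c *\<^sub>R y) *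
       (\<Sum>l\<in>{l. mle l (la + ka)}. C l * hermite 0 z l u * hermite 0 z (k' l) (c *\<^sub>R y))" for y
  proof -
    have "calH z la (h + (r / (1 + r)) *\<^sub>R y) * calH (z / r) ka (h - (1 / (1 + r)) *\<^sub>R y)
      = (hermite 0 z la (h + (r / (1 + r)) *\<^sub>R y) * hermite 0 (z / r) ka (h - (1 / (1 + r)) *\<^sub>R y)) *
        (maxwellian 0 z (h + (r / (1 + r)) *\<^sub>R y) * maxwellian 0 (z / r) (h - (1 / (1 + r)) *\<^sub>R y))"
      by (simp only: calH_def mult_ac)
    then show ?thesis
      unfolding hermite_pair_com[OF r z] maxwellian_pair_com[OF r z] u_def c_def C_def k'_def
      by (simp only: mult_ac)
  qed
  \<comment> \<open>Since |g'| = |g|, the Maxwellian is common to gain and loss and can be factored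
    out.\<close>
  have M: "maxwellian 0 z (c *\<^sub>R g') = maxwellian 0 z (c *\<^sub>R g)"
    by (simp add: maxwellian_def g'_def power_mult_distrib)
  have "A_integrand mi mj T Bk al la ka (com_map r (h, (g, p)))
     = B * (calH z la (h + (r / (1 + r)) *\<^sub>R g') * calH (z / r) ka (h - (1 / (1 + r)) *\<^sub>R g')
          - calH z la v * calH (z / r) ka vs) * hermite 0 z al v * sin (fst p)"
    unfolding A_integrand_def com_map_def Let_def fst_conv snd_conv zj z_def[symmetric] v_def[symmetric] vs_def[symmetric] d
    using vpost_com_map[OF mi mj, of h g "sph p"]
    by (simp add: v_def vs_def r_def B_def g'_def)
  also have "\<dots> = B * (r powr (3/2) * maxwellian 0 z u * maxwellian 0 z (c *\<^sub>R g) *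
       (\<Sum>l\<in>{l. mle l (la + ka)}. C l * hermite 0 z l u * (hermite 0 z (k' l) (c *\<^sub>R g') - hermite 0 z (k' l) (c *\<^sub>R g)))) *
       (\<Sum>m\<in>{m. mle m al}. K m * hermite 0 z m u * hermite 0 z (j m) (c *\<^sub>R g)) * sin (fst p)"
  proof -
    have "hermite 0 z al v = (\<Sum>m\<in>{m. mle m al}. K m * hermite 0 z m u * hermite 0 z (j m) (c *\<^sub>R g))"
      unfolding v_def K_def u_def c_def j_def by (rule hermite_com[OF r z])
    then show ?thesis
      unfolding H v_def vs_def M right_diff_distrib sum_subtractf by simp
  qed
  also have "\<dots> = (\<Sum>l\<in>{l. mle l (la + ka)}. C l * hermite 0 z l u * (hermite 0 z (k' l) (c *\<^sub>R g') - hermite 0 z (k' l) (c *\<^sub>R g))) *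
       (\<Sum>m\<in>{m. mle m al}. K m * hermite 0 z m u * hermite 0 z (j m) (c *\<^sub>R g)) *
       (r powr (3/2) * maxwellian 0 z u * maxwellian 0 z (c *\<^sub>R g) * B * sin (fst p))"
    by (simp only: mult_ac)
  also have "\<dots> = (\<Sum>l\<in>{l. mle l (la + ka)}. \<Sum>m\<in>{m. mle m al}.
       r powr (3/2) * C l * K m * ((hermite 0 z l u * hermite 0 z m u * maxwellian 0 z u) *
        gamma_integrand Bk r z (k' l) (j m) (g, p)))"
    unfolding sum_product unfolding sum_distrib_right
    by (intro sum.cong refl)
       (simp only: gamma_integrand_def Let_def fst_conv snd_conv g'_def[symmetric] c_def[symmetric] B_def[symmetric] mult_ac)
  finally show ?thesis unfolding C_def K_def k'_def j_def u_def .
qed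

section \<open>Termwise integration of the expansion and collection of the constants\<close>

theorem theorem1:
  fixes mi mj T :: real and Bk :: "real \<Rightarrow> real \<Rightarrow> real" and al la ka :: "nat^3"
  assumes mi_pos: "mi > 0" and mj_pos: "mj > 0" and T_pos: "T > 0"
    and Bk_nonneg: "\<And>a b. Bk a b \<ge> 0"
    and intA: "set_integrable lborel (UNIV \<times> UNIV \<times> sph_dom) (A_integrand mi mj T Bk al la ka)"
    and intG: "\<And>j k'. set_integrable lborel (UNIV \<times> sph_dom)
                        (gamma_integrand Bk (mj / mi) (T / mi) j k')"
  shows "A_coef mi mj T Bk al la ka =
    (let r = mj / mi; zi = T / mi in
     r powr (3/2) / (1 + r) powr ((real (mabs al) + 3) / 2) *
     (\<Sum>l' \<in> {l'. mle l' al \<and> mle l' (ka + la)}.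
        (let k' = (\<chi> i. ka$i + la$i - l'$i); j = (\<chi> i. al$i - l'$i) in
         r powr (real (mabs j) / 2) / real (mfact j)
         * ccoef (la$1) (ka$1) (l'$1) (k'$1) r
         * ccoef (la$2) (ka$2) (l'$2) (k'$2) r
         * ccoef (la$3) (ka$3) (l'$3) (k'$3) r
         * gamma_coef Bk r zi j k')))"
proof -
  define r where "r = mj / mi"
  define z where "z = T / mi"
  have r: "r > 0" and z: "z > 0" using mi_pos mj_pos T_pos by (auto simp: r_def z_def)
  note G = intG[folded r_def z_def]
  define C where "C l = (\<Prod>i\<in>UNIV. ccoef (la $ i) (ka $ i) (l $ i) (la $ i + ka $ i - l $ i) r)" for l
  define K where "K m = (\<Prod>i\<in>UNIV. real (al $ i choose m $ i) * (1 / sqrt (1 + r)) ^ (m $ i) * sqrt (r / (1 + r)) ^ (al $ i - m $ i))" for m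
  define k' where "k' l = (\<chi> i. la $ i + ka $ i - l $ i)" for l :: "nat^3"
  define j where "j m = (\<chi> i. al $ i - m $ i)" for m :: "nat^3"
  define F where "F l m h = hermite 0 z l (sqrt (1 + r) *\<^sub>R h) * hermite 0 z m (sqrt (1 + r) *\<^sub>R h) * maxwellian 0 z (sqrt (1 + r) *\<^sub>R h)" for l m h
  define \<Gamma> where "\<Gamma> l m y = indicator (UNIV \<times> sph_dom) y * gamma_integrand Bk r z (k' l) (j m) y" for l m y
  define L where "L = {l. mle l (la + ka)}"
  define N where "N = {m. mle m al}"
  have fin: "finite L" "finite N" unfolding L_def N_def by (rule finite_mle)+
  have F_int: "integrable lborel (F l m)" for l m
    unfolding F_def[abs_def] by (rule integrable_hermite_scaled[OF r z])
  have F_eq: "(LINT h|lborel. F l m h) = (1 + r) powr (-3/2) * (if l = m then real (mfact l) else 0)" for l m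
    unfolding F_def by (rule integral_hermite_scaled[OF r z])
  have \<Gamma>_int: "integrable lborel (\<Gamma> l m)" for l m
    using G[of "k' l" "j m"] by (simp add: \<Gamma>_def[abs_def] set_integrable_def)
  \<comment> \<open>The symmetry of \<open>gamma_coef\<close> restores the order of its two
    indices.\<close>
  have \<Gamma>_eq: "(LINT y|lborel. \<Gamma> l m y) = gamma_coef Bk r z (j m) (k' l)" for l m
    by (subst gamma_coef_sym[OF G]) (simp add: gamma_coef_def set_lebesgue_integral_def \<Gamma>_def[abs_def])
  let ?A = "\<lambda>x. indicator (UNIV \<times> UNIV \<times> sph_dom) x * A_integrand mi mj T Bk al la ka x"
  \<comment> \<open>The change of variables does not touch the angles, so the indicator of
    \<open>sph_dom\<close> passes into \<Gamma> and every term is a function of h times a function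
    of (g, p).\<close>
  have A_eq: "?A (com_map r x) = (\<Sum>l\<in>L. \<Sum>m\<in>N. r powr (3/2) * C l * K m * (F l m (fst x) * \<Gamma> l m (snd x)))" for x
  proof -
    obtain h g p where x: "x = (h, (g, p))" by (metis surj_pair)
    show ?thesis
    proof (cases "p \<in> sph_dom")
      case True
      have "?A (com_map r x) = A_integrand mi mj T Bk al la ka (com_map r (h, (g, p)))"
        using True by (simp add: x com_map_def)
      also have "\<dots> = (\<Sum>l\<in>L. \<Sum>m\<in>N. r powr (3/2) * C l * K m * (F l m (fst x) * \<Gamma> l m (snd x)))"
        unfolding A_integrand_com_map[OF mi_pos mj_pos T_pos, folded r_def z_def]
          L_def N_def C_def K_def F_def \<Gamma>_def k'_def j_def x using True by simp
      finally show ?thesis .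
    next
      case False
      then show ?thesis by (simp add: x com_map_def \<Gamma>_def)
    qed
  qed
  have "(LINT x : UNIV \<times> UNIV \<times> sph_dom | lborel. A_integrand mi mj T Bk al la ka x) = (LINT x|lborel. ?A x)"
    by (simp add: set_lebesgue_integral_def)
  also have "\<dots> = (LINT x|lborel. ?A (com_map r x))"
    using intA by (intro integral_com_map r) (auto simp: set_integrable_def dest: borel_measurable_integrable)
  also have "\<dots> = (\<Sum>l\<in>L. \<Sum>m\<in>N. r powr (3/2) * C l * K m * ((LINT h|lborel. F l m h) * (LINT y|lborel. \<Gamma> l m y)))"
    unfolding A_eq by (simp add: integrable_lborel_times integral_lborel_times F_int \<Gamma>_int)
  \<comment> \<open>Orthogonality in h keeps only m = l, a term that is present exactly when l also
    lies in \<open>N\<close>.\<close>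
  also have "\<dots> = (\<Sum>l\<in>L. if l \<in> N then r powr (3/2) * C l * K l * ((1 + r) powr (-3/2) * real (mfact l) * gamma_coef Bk r z (j l) (k' l)) else 0)"
    unfolding F_eq \<Gamma>_eq
  proof (rule sum.cong[OF refl])
    fix l
    have "(\<Sum>m\<in>N. r powr (3/2) * C l * K m * ((1 + r) powr (-3/2) * (if l = m then real (mfact l) else 0) * gamma_coef Bk r z (j m) (k' l)))
       = (\<Sum>m\<in>N. if l = m then r powr (3/2) * C l * K l * ((1 + r) powr (-3/2) * real (mfact l) * gamma_coef Bk r z (j l) (k' l)) else 0)"
      by (rule sum.cong) auto
    then show "(\<Sum>m\<in>N. r powr (3/2) * C l * K m * ((1 + r) powr (-3/2) * (if l = m then real (mfact l) else 0) * gamma_coef Bk r z (j m) (k' l)))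
       = (if l \<in> N then r powr (3/2) * C l * K l * ((1 + r) powr (-3/2) * real (mfact l) * gamma_coef Bk r z (j l) (k' l)) else 0)"
      using fin by simp
  qed
  also have "\<dots> = (\<Sum>l\<in>L \<inter> N. r powr (3/2) * C l * K l * ((1 + r) powr (-3/2) * real (mfact l) * gamma_coef Bk r z (j l) (k' l)))"
    by (rule sum.inter_restrict[OF fin(1), symmetric])
  finally have "A_coef mi mj T Bk al la ka =
     (\<Sum>l\<in>L \<inter> N. 1 / real (mfact al) * (r powr (3/2) * C l * K l * ((1 + r) powr (-3/2) * real (mfact l) * gamma_coef Bk r z (j l) (k' l))))"
    unfolding A_coef_def by (simp only: sum_distrib_left)
  also have "\<dots> = (\<Sum>l\<in>L \<inter> N. r powr (3/2) / (1 + r) powr ((real (mabs al) + 3) / 2) *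
     (r powr (real (mabs (j l)) / 2) / real (mfact (j l)) * C l * gamma_coef Bk r z (j l) (k' l)))"
  proof (rule sum.cong[OF refl])
    fix l assume "l \<in> L \<inter> N"
    then have le: "l $ i \<le> al $ i" for i by (simp add: N_def mle_def)
    have half: "sqrt x ^ n = x powr (real n / 2)" if "x > 0" for x :: real and n
      using that by (simp add: powr_half_sqrt[symmetric] powr_realpow[symmetric] powr_powr)
    \<comment> \<open>The exponents of sqrt (1 + r) add up to \<open>al $ i\<close>, so the power of
      1 + r no longer depends on l.\<close>
    have K1: "real (al $ i choose l $ i) * (1 / sqrt (1 + r)) ^ (l $ i) * sqrt (r / (1 + r)) ^ (al $ i - l $ i)
       = fact (al $ i) / (fact (l $ i) * fact (j l $ i)) * r powr (real (j l $ i) / 2) / (1 + r) powr (real (al $ i) / 2)" for i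
    proof -
      have "(1 / sqrt (1 + r)) ^ (l $ i) * sqrt (r / (1 + r)) ^ (al $ i - l $ i)
         = sqrt r ^ (j l $ i) / (sqrt (1 + r) ^ (l $ i) * sqrt (1 + r) ^ (j l $ i))"
        by (simp add: j_def real_sqrt_divide power_divide)
      also have "\<dots> = sqrt r ^ (j l $ i) / sqrt (1 + r) ^ (al $ i)"
        using le[of i] by (simp add: j_def power_add[symmetric])
      finally have "(1 / sqrt (1 + r)) ^ (l $ i) * sqrt (r / (1 + r)) ^ (al $ i - l $ i)
         = r powr (real (j l $ i) / 2) / (1 + r) powr (real (al $ i) / 2)"
        using r by (simp add: half)
      moreover have "real (al $ i choose l $ i) = fact (al $ i) / (fact (l $ i) * fact (j l $ i))"
        using binomial_fact[OF le[of i]] by (simp add: j_def)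
      ultimately show ?thesis by (simp only: mult.assoc times_divide_eq_right)
    qed
    have mf: "mfact n \<noteq> 0" for n by (simp add: mfact_def)
    \<comment> \<open>Here \<open>mfact al\<close> will cancel the prefactor of
      \<open>A_coef\<close> and \<open>mfact l\<close> the norm from orthogonality, leaving 1 /
      j!.\<close>
    have "K l = real (mfact al) / (real (mfact l) * real (mfact (j l))) * r powr (real (mabs (j l)) / 2) / (1 + r) powr (real (mabs al) / 2)"
      unfolding K_def K1 prod_UNIV_3
      by (simp add: mfact_def mabs_def add_divide_distrib powr_add mult_ac)
    moreover have "(1 + r) powr ((real (mabs al) + 3) / 2) = (1 + r) powr (real (mabs al) / 2) * (1 + r) powr (3/2)"
      by (simp add: add_divide_distrib powr_add)
    moreover have "(1 + r) powr (-3/2) = 1 / (1 + r) powr (3/2)"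
      using r by (simp add: powr_minus_divide)
    ultimately show "1 / real (mfact al) * (r powr (3/2) * C l * K l * ((1 + r) powr (-3/2) * real (mfact l) * gamma_coef Bk r z (j l) (k' l)))
      = r powr (3/2) / (1 + r) powr ((real (mabs al) + 3) / 2) *
        (r powr (real (mabs (j l)) / 2) / real (mfact (j l)) * C l * gamma_coef Bk r z (j l) (k' l))"
      by (simp add: mf mult_ac)
  qed
  also have "\<dots> = r powr (3/2) / (1 + r) powr ((real (mabs al) + 3) / 2) *
     (\<Sum>l \<in> {l. mle l al \<and> mle l (ka + la)}.
        r powr (real (mabs (j l)) / 2) / real (mfact (j l)) * C l * gamma_coef Bk r z (j l) (k' l))"
    unfolding sum_distrib_left L_def N_def by (intro sum.cong) (auto simp: add.commute)
  finally show ?thesis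
    unfolding Let_def r_def[symmetric] z_def[symmetric] j_def[symmetric]
    by (simp add: C_def prod_UNIV_3 k'_def add.commute mult.assoc)
qed

end
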